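(* Let $v>0$, $v\neq 1$ and $\mu>0$. Put $B=\mu(v^2-1)$, $A=1+B^2$. For the inverse central harmonic oscillator $\mathbf{F}(\mathbf{r})=-m\,\mathbf{r}/r^2$, the constant-speed ramps with velocity $v$ whose TreadmillSled curves are not contained in straight lines are parametrized, up to a rotation about the origin, a dilation centered at the origin and a reparametrization (and restriction to a subinterval), by $$\alpha(\varphi)=r(\varphi)\left(-\cos\Theta(\varphi),\ \sin\Theta(\varphi)\right),\qquad \varphi\in I,$$ where $$r(\varphi)=e^{-\mu v^2\varphi/A}\left(\frac{1}{\cos\varphi+B\sin\varphi}\right)^{\mu v^2B/A},\qquad \Theta(\varphi)=\frac{\mu v^2\left(B\varphi-\log(B\sin\varphi+\cos\varphi)\right)}{B^2+1},$$ and $I=(\arctan B-\tfrac{\pi}{2},\ \arctan B+\tfrac{\pi}{2})$ is the interval of length $\pi$ containing $0$ on which $\cos\varphi+B\sin\varphi>0$.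
   Context: Let $J(x,y)=(-y,x)$. For a smooth curve $\alpha$ in $\mathbb{R}^2\setminus\{0\}$ parametrized by arc-length on an interval, $\mathbf{n}(s)=J\alpha'(s)$ and $\kappa(s)=\langle\alpha''(s),\mathbf{n}(s)\rangle$. In this statement, a regular curve is called a constant-speed ramp with velocity $v$ for the inverse central harmonic oscillator (with kinetic friction coefficient $\mu>0$) if its arc-length parametrization satisfies $$\kappa(s)=-\frac{1}{v^2|\alpha(s)|^2}\left(\frac{\langle\alpha(s),\alpha'(s)\rangle}{\mu}+\langle\alpha(s),\mathbf{n}(s)\rangle\right)$$ for all $s$. (This equation is invariant under reversing the orientation of $\alpha$; the physical ramp is obtained by choosing the orientation for which $\langle\alpha,\alpha'\rangle\le 0$.) Reparametrizations are allowed to reverse the orientation. The TreadmillSled of an arc-length parametrized curve $\alpha$ is $\gamma(s)=-(\langle\alpha(s),\alpha'(s)\rangle,\langle\alpha(s),\mathbf{n}(s)\rangle)$; for a regular curve it is defined via an orientation-preserving arc-length reparametrization. *)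

theory Defs
  imports "HOL-Analysis.Analysis"
begin

text \<open>
  The plane is \<^typ>\<open>real \<times> real\<close> with its Euclidean norm and inner product.
  Curves are total functions of which only the restriction to a parameter interval matters;
  all derivatives are taken within that interval, so they are one-sided at an endpoint that
  belongs to it.
\<close>

type_synonym plane = "real \<times> real"

definition nondegenerate_interval :: "real set \<Rightarrow> bool" where
  "nondegenerate_interval S \<longleftrightarrow> is_interval S \<and> interior S \<noteq> {}"

definition deriv_on :: "real set \<Rightarrow> (real \<Rightarrow> 'a::real_normed_vector) \<Rightarrow> real \<Rightarrow> 'a" where
  "deriv_on S f t = vector_derivative f (at t within S)"

definition smooth_on_interval :: "real set \<Rightarrow> (real \<Rightarrow> 'a::real_normed_vector) \<Rightarrow> bool" where
  "smooth_on_interval S f \<longleftrightarrow> (\<forall>k. (deriv_on S ^^ k) f differentiable_on S)"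

text \<open>Diffeomorphisms between intervals; the orientation may be reversed.\<close>

definition reparametrization :: "(real \<Rightarrow> real) \<Rightarrow> real set \<Rightarrow> real set \<Rightarrow> bool" where
  "reparametrization h S T \<longleftrightarrow>
     nondegenerate_interval S \<and> nondegenerate_interval T \<and>
     bij_betw h S T \<and> smooth_on_interval S h \<and> (\<forall>t\<in>S. deriv_on S h t \<noteq> 0)"

definition orientation_preserving :: "(real \<Rightarrow> real) \<Rightarrow> real set \<Rightarrow> bool" where
  "orientation_preserving h S \<longleftrightarrow> (\<forall>t\<in>S. deriv_on S h t > 0)"

text \<open>Regular curves are understood to avoid the origin.\<close>

definition regular_curve :: "(real \<Rightarrow> plane) \<Rightarrow> real set \<Rightarrow> bool" where
  "regular_curve \<beta> S \<longleftrightarrow>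
     nondegenerate_interval S \<and> smooth_on_interval S \<beta> \<and>
     (\<forall>t\<in>S. deriv_on S \<beta> t \<noteq> 0 \<and> \<beta> t \<noteq> 0)"

definition arc_length_curve :: "(real \<Rightarrow> plane) \<Rightarrow> real set \<Rightarrow> bool" where
  "arc_length_curve \<alpha> L \<longleftrightarrow> regular_curve \<alpha> L \<and> (\<forall>s\<in>L. norm (deriv_on L \<alpha> s) = 1)"

text \<open>
  The pair \<open>(\<alpha>, L)\<close> is an orientation-preserving arc-length reparametrization of \<open>(\<beta>, S)\<close>.
  It exists for every regular curve and is unique up to a translation of the parameter.
\<close>

definition arc_length_reparam ::
  "(real \<Rightarrow> plane) \<Rightarrow> real set \<Rightarrow> (real \<Rightarrow> plane) \<Rightarrow> real set \<Rightarrow> bool" where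
  "arc_length_reparam \<beta> S \<alpha> L \<longleftrightarrow>
     arc_length_curve \<alpha> L \<and>
     (\<exists>\<sigma>. reparametrization \<sigma> S L \<and> orientation_preserving \<sigma> S \<and> (\<forall>t\<in>S. \<beta> t = \<alpha> (\<sigma> t)))"

fun Jrot :: "plane \<Rightarrow> plane" where
  "Jrot (x, y) = (- y, x)"

definition unit_normal :: "real set \<Rightarrow> (real \<Rightarrow> plane) \<Rightarrow> real \<Rightarrow> plane" where
  "unit_normal L \<alpha> s = Jrot (deriv_on L \<alpha> s)"

definition curvature :: "real set \<Rightarrow> (real \<Rightarrow> plane) \<Rightarrow> real \<Rightarrow> real" where
  "curvature L \<alpha> s = inner (deriv_on L (deriv_on L \<alpha>) s) (unit_normal L \<alpha> s)"

definition constant_speed_ramp :: "real \<Rightarrow> real \<Rightarrow> (real \<Rightarrow> plane) \<Rightarrow> real set \<Rightarrow> bool" where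
  "constant_speed_ramp v \<mu> \<beta> S \<longleftrightarrow>
     regular_curve \<beta> S \<and>
     (\<exists>\<alpha> L. arc_length_reparam \<beta> S \<alpha> L \<and>
        (\<forall>s\<in>L. curvature L \<alpha> s =
           - (1 / (v\<^sup>2 * (norm (\<alpha> s))\<^sup>2)) *
             (inner (\<alpha> s) (deriv_on L \<alpha> s) / \<mu> + inner (\<alpha> s) (unit_normal L \<alpha> s))))"

definition treadmill_sled :: "real set \<Rightarrow> (real \<Rightarrow> plane) \<Rightarrow> real \<Rightarrow> plane" where
  "treadmill_sled L \<alpha> s =
     - (inner (\<alpha> s) (deriv_on L \<alpha> s), inner (\<alpha> s) (unit_normal L \<alpha> s))"

definition treadmill_sled_in_line :: "(real \<Rightarrow> plane) \<Rightarrow> real set \<Rightarrow> bool" where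
  "treadmill_sled_in_line \<beta> S \<longleftrightarrow>
     (\<exists>\<alpha> L. arc_length_reparam \<beta> S \<alpha> L \<and> collinear (treadmill_sled L \<alpha> ` L))"

fun rotation :: "real \<Rightarrow> plane \<Rightarrow> plane" where
  "rotation \<omega> (x, y) = (cos \<omega> * x - sin \<omega> * y, sin \<omega> * x + cos \<omega> * y)"

end

theory Submission
  imports Defs
begin

text \<open>
  For an arc-length curve with unit tangent \<open>T\<close> and normal \<open>N\<close> write \<open>X = \<langle>\<alpha>, T\<rangle>\<close> and \<open>Y = \<langle>\<alpha>, N\<rangle>\<close>.
  The ramp equation gives \<open>E' = - E (Y - \<mu> X) / (\<mu> v\<^sup>2 |\<alpha>|\<^sup>2)\<close> for \<open>E = B Y - X\<close>, a linear
  equation: either \<open>E\<close> vanishes identically and the TreadmillSled lies on a line through the origin,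
  or \<open>E\<close> has no zero. In the second case \<open>\<phi> = arctan B + arctan ((Y + B X) / E)\<close> has derivative
  \<open>E / (\<mu> v\<^sup>2 |\<alpha>|\<^sup>2)\<close>, hence is an admissible parameter, and the complex quotient of the curve by the
  explicit one at \<open>\<phi>\<close> has derivative zero, hence is a constant \<open>c e\<^sup>i\<^sup>\<omega>\<close>.
  Conversely, the TreadmillSled of the explicit curve is \<open>\<plusminus>c r(\<phi>) (cos \<phi>, - sin \<phi>)\<close>, and
  differentiating an affine relation between its coordinates gives a quadratic form in
  \<open>(cos \<phi>, sin \<phi>)\<close> vanishing on an interval, whose coefficients cannot all be zero because \<open>B \<noteq> 0\<close>.
\<close>

subsection \<open>Differentiability of finite order on an interval\<close>

text \<open>The derivative is an arbitrary witness \<open>f'\<close>, so closure under sums,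
  products and composition is a plain induction on \<open>n\<close>. On a nondegenerate interval,
  holding for all \<open>n\<close> amounts to \<open>smooth_on_interval\<close>.\<close>

primrec ndiff :: "nat \<Rightarrow> real set \<Rightarrow> (real \<Rightarrow> 'a::real_normed_vector) \<Rightarrow> bool" where
  "ndiff 0 S f \<longleftrightarrow> True"
| "ndiff (Suc n) S f \<longleftrightarrow>
     (\<exists>f'. (\<forall>t\<in>S. (f has_vector_derivative f' t) (at t within S)) \<and> ndiff n S f')"

lemma ndiff_SucI:
  assumes "\<And>t. t \<in> S \<Longrightarrow> (f has_vector_derivative f' t) (at t within S)" "ndiff n S f'"
  shows "ndiff (Suc n) S f"
  using assms by auto

lemma ndiff_SucD: "ndiff (Suc n) S f \<Longrightarrow> ndiff n S f"
  by (induction n arbitrary: f) auto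

lemma ndiff_cong:
  assumes "\<And>t. t \<in> S \<Longrightarrow> f t = g t" "ndiff n S f"
  shows "ndiff n S g"
proof (cases n)
  case (Suc m)
  then obtain f' where f': "\<And>t. t \<in> S \<Longrightarrow> (f has_vector_derivative f' t) (at t within S)" "ndiff m S f'"
    using assms by auto
  have "(g has_vector_derivative f' t) (at t within S)" if "t \<in> S" for t
    by (rule has_vector_derivative_transform[OF that _ f'(1)[OF that]]) (simp add: assms(1))
  then show ?thesis unfolding Suc using f'(2) by (rule ndiff_SucI)
qed auto

lemma ndiff_const: "ndiff n S (\<lambda>t. c)"
  by (induction n arbitrary: c) (auto intro!: exI[of _ "\<lambda>t. 0"] derivative_eq_intros)

lemma ndiff_ident: "ndiff n S (\<lambda>t::real. t)"
  by (cases n) (auto intro!: exI[of _ "\<lambda>t. 1"] derivative_eq_intros ndiff_const)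

lemma ndiff_bounded_linear:
  assumes "bounded_linear L" "ndiff n S f"
  shows "ndiff n S (\<lambda>t. L (f t))"
  using assms(2)
proof (induction n arbitrary: f)
  case (Suc n)
  then obtain f' where "\<forall>t\<in>S. (f has_vector_derivative f' t) (at t within S)" "ndiff n S f'"
    by auto
  with Suc.IH show ?case
    by (intro ndiff_SucI[of S _ "\<lambda>t. L (f' t)"])
       (auto intro: bounded_linear.has_vector_derivative[OF assms(1)])
qed auto

lemma ndiff_add:
  "ndiff n S f \<Longrightarrow> ndiff n S g \<Longrightarrow> ndiff n S (\<lambda>t. f t + g t)"
proof (induction n arbitrary: f g)
  case (Suc n)
  then obtain f' g' where
    "\<forall>t\<in>S. (f has_vector_derivative f' t) (at t within S)" "ndiff n S f'"
    "\<forall>t\<in>S. (g has_vector_derivative g' t) (at t within S)" "ndiff n S g'"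
    by auto
  with Suc.IH show ?case
    by (intro ndiff_SucI[of S _ "\<lambda>t. f' t + g' t"]) (auto intro!: derivative_eq_intros)
qed auto

lemma ndiff_Pair:
  "ndiff n S f \<Longrightarrow> ndiff n S g \<Longrightarrow> ndiff n S (\<lambda>t. (f t, g t))"
proof (induction n arbitrary: f g)
  case (Suc n)
  then obtain f' g' where
    "\<forall>t\<in>S. (f has_vector_derivative f' t) (at t within S)" "ndiff n S f'"
    "\<forall>t\<in>S. (g has_vector_derivative g' t) (at t within S)" "ndiff n S g'"
    by auto
  with Suc.IH show ?case
    by (intro ndiff_SucI[of S _ "\<lambda>t. (f' t, g' t)"]) (auto intro!: has_vector_derivative_Pair)
qed auto

lemma ndiff_minus: "ndiff n S f \<Longrightarrow> ndiff n S (\<lambda>t. - f t)"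
  by (rule ndiff_bounded_linear[OF bounded_linear_minus[OF bounded_linear_ident]])

lemma ndiff_diff:
  "ndiff n S f \<Longrightarrow> ndiff n S g \<Longrightarrow> ndiff n S (\<lambda>t. f t - g t)"
  using ndiff_add[of n S f "\<lambda>t. - g t"] by (simp add: ndiff_minus)

lemma ndiff_scaleR:
  fixes f :: "real \<Rightarrow> real" and g :: "real \<Rightarrow> 'a::real_normed_vector"
  shows "ndiff n S f \<Longrightarrow> ndiff n S g \<Longrightarrow> ndiff n S (\<lambda>t. f t *\<^sub>R g t)"
proof (induction n arbitrary: f g)
  case (Suc n)
  then obtain f' g' where *:
    "\<forall>t\<in>S. (f has_vector_derivative f' t) (at t within S)" "ndiff n S f'"
    "\<forall>t\<in>S. (g has_vector_derivative g' t) (at t within S)" "ndiff n S g'"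
    by auto
  moreover have "ndiff n S f" "ndiff n S g"
    using Suc.prems by (auto dest: ndiff_SucD simp del: ndiff.simps)
  ultimately show ?case using Suc.IH
    by (intro ndiff_SucI[of S _ "\<lambda>t. f t *\<^sub>R g' t + f' t *\<^sub>R g t"])
       (auto intro!: ndiff_add has_vector_derivative_scaleR
             simp: has_real_derivative_iff_has_vector_derivative)
qed auto

lemma ndiff_mult:
  fixes f g :: "real \<Rightarrow> real"
  shows "ndiff n S f \<Longrightarrow> ndiff n S g \<Longrightarrow> ndiff n S (\<lambda>t. f t * g t)"
  using ndiff_scaleR[of n S f g] by simp

text \<open>By the chain rule the derivative is \<open>h'\<close> times the composite of
  \<open>f'\<close> with \<open>h\<close>; the induction hypothesis handles that composite because
  \<open>h\<close> also has the lower order.\<close>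

lemma ndiff_compose:
  fixes h :: "real \<Rightarrow> real"
  shows "ndiff n T f \<Longrightarrow> ndiff n S h \<Longrightarrow> h ` S \<subseteq> T \<Longrightarrow> ndiff n S (\<lambda>t. f (h t))"
proof (induction n arbitrary: f)
  case (Suc n)
  then obtain f' h' where *:
    "\<forall>t\<in>T. (f has_vector_derivative f' t) (at t within T)" "ndiff n T f'"
    "\<forall>t\<in>S. (h has_vector_derivative h' t) (at t within S)" "ndiff n S h'"
    by auto
  have "((f \<circ> h) has_vector_derivative h' t *\<^sub>R f' (h t)) (at t within S)" if "t \<in> S" for t
    using * Suc.prems(3) that
    by (intro vector_diff_chain_within has_vector_derivative_within_subset[of f _ _ T "h ` S"]) auto
  moreover have "ndiff n S h"
    using Suc.prems by (auto dest: ndiff_SucD simp del: ndiff.simps)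
  ultimately show ?case using Suc.IH Suc.prems(3) *
    by (intro ndiff_SucI[of S _ "\<lambda>t. h' t *\<^sub>R f' (h t)"]) (auto intro!: ndiff_scaleR simp: o_def)
qed auto

text \<open>The induction closes because the derivative is a product of \<open>f'\<close> and
  \<open>inverse f\<close>, the latter known to have the previous order.\<close>

lemma ndiff_inverse:
  fixes f :: "real \<Rightarrow> real"
  assumes "\<And>t. t \<in> S \<Longrightarrow> f t \<noteq> 0"
  shows "ndiff n S f \<Longrightarrow> ndiff n S (\<lambda>t. inverse (f t))"
proof (induction n)
  case (Suc n)
  then obtain f' where *:
    "\<forall>t\<in>S. (f has_vector_derivative f' t) (at t within S)" "ndiff n S f'"
    by auto
  have "((\<lambda>t. inverse (f t)) has_vector_derivative - (inverse (f t) * f' t * inverse (f t)))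
      (at t within S)" if "t \<in> S" for t
    using * that assms
    by (auto intro!: derivative_eq_intros simp flip: has_real_derivative_iff_has_vector_derivative)
  then show ?case using * Suc
    by (intro ndiff_SucI[of S _ "\<lambda>t. - (inverse (f t) * f' t * inverse (f t))"])
       (auto intro!: ndiff_minus ndiff_mult intro: ndiff_SucD simp del: ndiff.simps)
qed auto

lemma ndiff_divide:
  fixes f g :: "real \<Rightarrow> real"
  assumes "\<And>t. t \<in> S \<Longrightarrow> g t \<noteq> 0" "ndiff n S f" "ndiff n S g"
  shows "ndiff n S (\<lambda>t. f t / g t)"
  unfolding divide_inverse using assms by (intro ndiff_mult ndiff_inverse)

lemma ndiff_exp:
  fixes f :: "real \<Rightarrow> real"
  shows "ndiff n S f \<Longrightarrow> ndiff n S (\<lambda>t. exp (f t))"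
proof (induction n)
  case (Suc n)
  then obtain f' where *:
    "\<forall>t\<in>S. (f has_vector_derivative f' t) (at t within S)" "ndiff n S f'"
    by auto
  have "((\<lambda>t. exp (f t)) has_vector_derivative f' t * exp (f t)) (at t within S)" if "t \<in> S" for t
    using * that
    by (auto intro!: derivative_eq_intros simp flip: has_real_derivative_iff_has_vector_derivative)
  then show ?case using * Suc
    by (intro ndiff_SucI[of S _ "\<lambda>t. f' t * exp (f t)"])
       (auto intro!: ndiff_mult intro: ndiff_SucD simp del: ndiff.simps)
qed auto

text \<open>The two functions occur in each other's derivative, so one induction carries
  both.\<close>

lemma ndiff_sin_cos:
  fixes f :: "real \<Rightarrow> real"
  shows "ndiff n S f \<Longrightarrow> ndiff n S (\<lambda>t. sin (f t)) \<and> ndiff n S (\<lambda>t. cos (f t))"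
proof (induction n)
  case (Suc n)
  then obtain f' where *:
    "\<forall>t\<in>S. (f has_vector_derivative f' t) (at t within S)" "ndiff n S f'"
    by auto
  have "((\<lambda>t. sin (f t)) has_vector_derivative f' t * cos (f t)) (at t within S)"
    "((\<lambda>t. cos (f t)) has_vector_derivative - (f' t * sin (f t))) (at t within S)" if "t \<in> S" for t
    using * that
    by (auto intro!: derivative_eq_intros simp flip: has_real_derivative_iff_has_vector_derivative)
  then show ?case using * Suc
    by (intro conjI ndiff_SucI[of S _ "\<lambda>t. f' t * cos (f t)"]
          ndiff_SucI[of S _ "\<lambda>t. - (f' t * sin (f t))"])
       (auto intro!: ndiff_minus ndiff_mult intro: ndiff_SucD simp del: ndiff.simps)
qed auto

lemma ndiff_sin: "ndiff n S f \<Longrightarrow> ndiff n S (\<lambda>t. sin (f t :: real))"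
  and ndiff_cos: "ndiff n S f \<Longrightarrow> ndiff n S (\<lambda>t. cos (f t :: real))"
  using ndiff_sin_cos by blast+

text \<open>One differentiation leads to the quotient \<open>f' / f\<close>, which
  \<open>ndiff_divide\<close> covers, so a case split replaces the induction. The arctangent below
  works in the same way.\<close>

lemma ndiff_ln:
  fixes f :: "real \<Rightarrow> real"
  assumes "\<And>t. t \<in> S \<Longrightarrow> f t > 0" "ndiff n S f"
  shows "ndiff n S (\<lambda>t. ln (f t))"
proof (cases n)
  case (Suc m)
  then obtain f' where *:
    "\<forall>t\<in>S. (f has_vector_derivative f' t) (at t within S)" "ndiff m S f'"
    using assms by auto
  have "((\<lambda>t. ln (f t)) has_vector_derivative f' t / f t) (at t within S)" if "t \<in> S" for t
    using * that assms(1)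
    by (auto intro!: derivative_eq_intros simp flip: has_real_derivative_iff_has_vector_derivative)
  moreover have "ndiff m S f" using assms(2) Suc ndiff_SucD by blast
  ultimately show ?thesis using * assms(1) unfolding Suc
    by (intro ndiff_SucI[of S _ "\<lambda>t. f' t / f t"] ndiff_divide) fastforce+
qed auto

lemma ndiff_arctan:
  assumes "ndiff n S f"
  shows "ndiff n S (\<lambda>t. arctan (f t))"
proof (cases n)
  case (Suc m)
  then obtain f' where *:
    "\<forall>t\<in>S. (f has_vector_derivative f' t) (at t within S)" "ndiff m S f'"
    using assms by auto
  have "((\<lambda>t. arctan (f t)) has_vector_derivative f' t / (1 + f t * f t)) (at t within S)"
    if "t \<in> S" for t
    using * that
    by (auto intro!: derivative_eq_intros
          simp: power2_eq_square divide_inverse simp flip: has_real_derivative_iff_has_vector_derivative)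
  moreover have "ndiff m S f" using assms Suc ndiff_SucD by blast
  moreover have "1 + f t * f t \<noteq> 0" for t
    by (metis add_pos_nonneg less_irrefl zero_le_square zero_less_one)
  ultimately show ?thesis using * unfolding Suc
    by (intro ndiff_SucI[of S _ "\<lambda>t. f' t / (1 + f t * f t)"] ndiff_divide)
       (auto intro!: ndiff_add ndiff_mult ndiff_const)
qed auto

subsection \<open>Nondegenerate intervals\<close>

text \<open>The form with two points is easy to check for the image of an interval under an
  injective continuous map.\<close>

lemma nondegenerate_interval_iff:
  "nondegenerate_interval S \<longleftrightarrow> is_interval S \<and> (\<exists>a\<in>S. \<exists>b\<in>S. a < b)"
proof
  assume S: "nondegenerate_interval S"
  then obtain x where "x \<in> interior S" unfolding nondegenerate_interval_def by auto
  then obtain e where e: "e > 0" "cball x e \<subseteq> S" by (auto simp: mem_interior_cball)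
  then have "x \<in> S" "x + e \<in> S" by (auto simp: subset_iff dist_norm)
  then show "is_interval S \<and> (\<exists>a\<in>S. \<exists>b\<in>S. a < b)"
    using S e(1) unfolding nondegenerate_interval_def by (metis less_add_same_cancel1)
next
  assume S: "is_interval S \<and> (\<exists>a\<in>S. \<exists>b\<in>S. a < b)"
  then obtain a b where ab: "a \<in> S" "b \<in> S" "a < b" by auto
  then have "{a<..<b} \<subseteq> S" using S by (meson greaterThanLessThan_iff is_interval_1 less_imp_le subsetI)
  then have "{a<..<b} \<subseteq> interior S" by (simp add: interior_maximal)
  then show "nondegenerate_interval S"
    using S ab(3) unfolding nondegenerate_interval_def by fastforce
qed

text \<open>A connected set with more than one point has no isolated point. This makes derivatives
  within \<open>S\<close> unique, endpoints included.\<close>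

lemma at_within_nondegenerate_interval:
  assumes "nondegenerate_interval S" "t \<in> S"
  shows "at t within S \<noteq> bot"
proof -
  obtain a b where ab: "a \<in> S" "b \<in> S" "a < b" and S: "is_interval S"
    using assms(1) by (auto simp: nondegenerate_interval_iff)
  have "connected S" using S by (simp add: is_interval_connected)
  moreover have "\<not> S \<subseteq> {t}" using ab by auto
  ultimately show ?thesis
    using assms(2) connected_imp_perfect[of S t] by (auto simp: trivial_limit_within)
qed

lemma deriv_on_eqI:
  assumes "nondegenerate_interval S" "t \<in> S" "(f has_vector_derivative f') (at t within S)"
  shows "deriv_on S f t = f'"
  unfolding deriv_on_def
  using assms by (intro vector_derivative_within at_within_nondegenerate_interval)

text \<open>From left to right the iterates of \<open>deriv_on\<close> serve as witnesses. From
  right to left, uniqueness of derivatives forces every witness to agree with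
  \<open>deriv_on S f\<close> on \<open>S\<close>.\<close>

lemma smooth_on_interval_iff_ndiff:
  assumes "nondegenerate_interval S"
  shows "smooth_on_interval S f \<longleftrightarrow> (\<forall>n. ndiff n S f)"
proof
  assume "smooth_on_interval S f"
  then show "\<forall>n. ndiff n S f"
  proof (rule_tac allI)
    fix n
    show "smooth_on_interval S f \<Longrightarrow> ndiff n S f"
    proof (induction n arbitrary: f)
      case (Suc n)
      have "f differentiable_on S"
        using Suc.prems by (auto simp: smooth_on_interval_def dest: spec[of _ 0])
      then have "(f has_vector_derivative deriv_on S f t) (at t within S)" if "t \<in> S" for t
        using that by (simp add: deriv_on_def differentiable_on_def flip: vector_derivative_works)
      moreover have "smooth_on_interval S (deriv_on S f)"
        using Suc.prems unfolding smooth_on_interval_def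
        by (metis comp_apply funpow_Suc_right)
      ultimately show ?case using Suc.IH by auto
    qed auto
  qed
next
  \<comment> \<open>Order \<open>Suc k\<close>: \<open>k\<close> derivatives to form the iterate and
    one more to differentiate it.\<close>
  have *: "ndiff (Suc k) S f \<Longrightarrow> (deriv_on S ^^ k) f differentiable_on S" for k
  proof (induction k arbitrary: f)
    case 0
    then show ?case
      by (auto simp: differentiable_on_def has_vector_derivative_def differentiable_def)
  next
    case (Suc k)
    then obtain f' where f': "\<And>t. t \<in> S \<Longrightarrow> (f has_vector_derivative f' t) (at t within S)"
      "ndiff (Suc k) S f'" by (auto simp del: ndiff.simps simp: ndiff.simps(2)[of "Suc k"])
    have "ndiff (Suc k) S (deriv_on S f)"
      using f' deriv_on_eqI[OF assms, symmetric] by (intro ndiff_cong[OF _ f'(2)]) blast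
    from Suc.IH[OF this] show ?case by (simp add: funpow_swap1)
  qed
  assume "\<forall>n. ndiff n S f"
  with * show "smooth_on_interval S f" unfolding smooth_on_interval_def by blast
qed

lemma smooth_on_intervalD:
  assumes "smooth_on_interval S f"
  shows "t \<in> S \<Longrightarrow> (f has_vector_derivative deriv_on S f t) (at t within S)"
    and "smooth_on_interval S (deriv_on S f)"
proof -
  have "f differentiable_on S"
    using assms by (auto simp: smooth_on_interval_def dest: spec[of _ 0])
  then show "t \<in> S \<Longrightarrow> (f has_vector_derivative deriv_on S f t) (at t within S)"
    by (simp add: deriv_on_def differentiable_on_def flip: vector_derivative_works)
  show "smooth_on_interval S (deriv_on S f)"
    using assms unfolding smooth_on_interval_def by (metis comp_apply funpow_Suc_right)
qed

lemma smooth_on_interval_continuous: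
  "smooth_on_interval S f \<Longrightarrow> continuous_on S f"
  using smooth_on_intervalD(1)
  by (meson continuous_on_eq_continuous_within has_vector_derivative_continuous)

text \<open>By Rolle, two points of \<open>S\<close> with equal values would enclose a zero of the
  derivative.\<close>

lemma deriv_on_nonzero_inj:
  fixes h :: "real \<Rightarrow> real"
  assumes S: "is_interval S" and h: "\<And>t. t \<in> S \<Longrightarrow> (h has_real_derivative h' t) (at t within S)"
    and nz: "\<And>t. t \<in> S \<Longrightarrow> h' t \<noteq> 0"
  shows "inj_on h S"
proof -
  have False if "a \<in> S" "b \<in> S" "a < b" "h a = h b" for a b
  proof -
    have sub: "{a..b} \<subseteq> S" using S that by (meson atLeastAtMost_iff is_interval_1 subsetI)
    \<comment> \<open>Rolle asks for two-sided derivatives, which exist at the interior points of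
      the segment.\<close>
    have "(h has_real_derivative h' x) (at x)" if "a < x" "x < b" for x
    proof -
      have "x \<in> S" "{a<..<b} \<subseteq> S" using sub that by auto
      then have "(h has_real_derivative h' x) (at x within {a<..<b})"
        using h DERIV_subset by blast
      then show ?thesis using that by (simp add: at_within_open[of x "{a<..<b}"])
    qed
    moreover have "continuous_on {a..b} h"
      using h sub by (meson DERIV_continuous continuous_on_eq_continuous_within continuous_on_subset)
    ultimately obtain z where z: "a < z" "z < b" "(\<lambda>y. h' z * y) = (\<lambda>y. 0)"
      using Rolle_deriv[OF \<open>a < b\<close> \<open>h a = h b\<close>, of "\<lambda>x y. h' x * y"]
      by (auto simp: has_field_derivative_def)
    from fun_cong[OF z(3), of 1] have "h' z = 0" by simp
    moreover have "z \<in> S" using z sub by auto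
    ultimately show False using nz by blast
  qed
  then show ?thesis unfolding inj_on_def by (metis linorder_neqE_linordered_idom)
qed

text \<open>The image is connected, hence an interval, and injectivity gives it two distinct
  points.\<close>

lemma reparametrizationI:
  fixes h :: "real \<Rightarrow> real"
  assumes S: "nondegenerate_interval S" and sm: "smooth_on_interval S h"
    and nz: "\<And>t. t \<in> S \<Longrightarrow> deriv_on S h t \<noteq> 0"
  shows "reparametrization h S (h ` S)"
proof -
  have inj: "inj_on h S"
    using S sm nz deriv_on_nonzero_inj[of S h "deriv_on S h"] smooth_on_intervalD(1)
    by (auto simp: has_real_derivative_iff_has_vector_derivative nondegenerate_interval_def)
  obtain a b where ab: "a \<in> S" "b \<in> S" "a < b" and iS: "is_interval S"
    using S by (auto simp: nondegenerate_interval_iff)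
  have "is_interval (h ` S)"
    using connected_continuous_image[OF smooth_on_interval_continuous[OF sm]] iS
    by (simp add: is_interval_connected_1)
  moreover have "h a \<noteq> h b" using inj ab by (auto simp: inj_on_def)
  ultimately have "nondegenerate_interval (h ` S)"
    using ab by (auto simp: nondegenerate_interval_iff) (meson linorder_neqE_linordered_idom)
  then show ?thesis using assms inj unfolding reparametrization_def bij_betw_def by auto
qed

text \<open>The inverse function theorem on an interval: \<open>g\<close> is continuous, its
  derivative is the reciprocal of \<open>h'\<close> at \<open>g\<close>, and smoothness follows from
  that formula.\<close>

lemma reparametrization_inverse:
  assumes h: "reparametrization h S T"
  defines "g \<equiv> inv_into S h"
  shows "smooth_on_interval T g"
    and "\<And>t. t \<in> T \<Longrightarrow> (g has_real_derivative 1 / deriv_on S h (g t)) (at t within T)"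
proof -
  have S: "nondegenerate_interval S" and T: "nondegenerate_interval T"
    and bij: "bij_betw h S T" and sm: "smooth_on_interval S h"
    and nz: "\<And>t. t \<in> S \<Longrightarrow> deriv_on S h t \<noteq> 0"
    using h by (auto simp: reparametrization_def)
  have gS: "g t \<in> S" "h (g t) = t" if "t \<in> T" for t
    using bij that unfolding g_def
    by (simp_all add: bij_betw_inv_into_right bij_betwE[OF bij_betw_inv_into])
  have hT: "h s \<in> T" "g (h s) = s" if "s \<in> S" for s
    using bij that unfolding g_def by (simp_all add: bij_betw_inv_into_left bij_betwE)
  have "is_interval S" using S by (simp add: nondegenerate_interval_def)
  \<comment> \<open>An injective continuous function on an interval is a homeomorphism onto its
    image. Its inverse agrees with \<open>g\<close> on \<open>T\<close>, whence \<open>g\<close> is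
    continuous.\<close>
  then obtain g0 where g0: "homeomorphism S T h g0"
    using homeomorphism_into_1d[of S h T] smooth_on_interval_continuous[OF sm] bij
    by (auto simp: bij_betw_def is_interval_path_connected)
  have cont: "continuous_on T g"
  proof (rule continuous_on_eq)
    show "continuous_on T g0" using g0 by (simp add: homeomorphism_def)
    show "g0 x = g x" if "x \<in> T" for x
      using g0 gS[OF that] that by (metis homeomorphism_apply1)
  qed
  show deriv: "(g has_real_derivative 1 / deriv_on S h (g t)) (at t within T)" if t: "t \<in> T" for t
  proof -
    have "(h has_real_derivative deriv_on S h (g t)) (at (g t) within S)"
      using smooth_on_intervalD(1)[OF sm gS(1)[OF t]]
      by (simp add: has_real_derivative_iff_has_vector_derivative)
    then have lim: "((\<lambda>s. (h s - h (g t)) / (s - g t)) \<longlongrightarrow> deriv_on S h (g t)) (at (g t) within S)"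
      by (simp add: has_field_derivative_iff)
    \<comment> \<open>Injectivity keeps \<open>g\<close> away from the value \<open>g t\<close> off
      \<open>t\<close>, so the difference quotient of \<open>h\<close> at \<open>g t\<close> may be
      composed with \<open>g\<close> and then inverted.\<close>
    have "filterlim g (at (g t) within S) (at t within T)"
      unfolding filterlim_at
    proof
      show "\<forall>\<^sub>F x in at t within T. g x \<in> S \<and> g x \<noteq> g t"
        unfolding eventually_at_filter using t gS by (intro always_eventually) metis
      show "(g \<longlongrightarrow> g t) (at t within T)"
        using cont t by (simp add: continuous_on)
    qed
    from tendsto_inverse[OF filterlim_compose[OF lim this] nz[OF gS(1)[OF t]]]
    have "((\<lambda>u. inverse ((h (g u) - h (g t)) / (g u - g t))) \<longlongrightarrow> 1 / deriv_on S h (g t))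
        (at t within T)" by (simp add: inverse_eq_divide)
    then have "((\<lambda>u. (g u - g t) / (u - t)) \<longlongrightarrow> 1 / deriv_on S h (g t)) (at t within T)"
      by (rule Lim_transform_eventually) (use gS t in \<open>auto simp: eventually_at_filter\<close>)
    then show ?thesis by (simp add: has_field_derivative_iff)
  qed
  \<comment> \<open>Bootstrap: order \<open>n\<close> of \<open>g\<close> gives order
    \<open>n\<close> of its derivative, hence order \<open>Suc n\<close> of
    \<open>g\<close>.\<close>
  have "ndiff n T g" for n
  proof (induction n)
    case (Suc n)
    have "ndiff n T (\<lambda>t. 1 / deriv_on S h (g t))"
    proof (intro ndiff_divide ndiff_const ndiff_compose[OF _ Suc])
      show "ndiff n S (deriv_on S h)"
        using smooth_on_intervalD(2)[OF sm] smooth_on_interval_iff_ndiff[OF S] by blast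
    qed (use gS nz in auto)
    then show ?case using deriv
      by (intro ndiff_SucI[of T g "\<lambda>t. 1 / deriv_on S h (g t)"])
         (auto simp flip: has_real_derivative_iff_has_vector_derivative)
  qed auto
  then show "smooth_on_interval T g" using smooth_on_interval_iff_ndiff[OF T] by blast
qed

lemmas ndiff_intros = ndiff_const ndiff_ident ndiff_minus ndiff_add ndiff_diff ndiff_mult
  ndiff_scaleR ndiff_Pair ndiff_exp ndiff_sin ndiff_cos

section \<open>Constancy of sign and linear differential equations on an interval\<close>

lemma nonzero_constant_sign:
  fixes f :: "real \<Rightarrow> real"
  assumes "is_interval S" "continuous_on S f" "\<And>t. t \<in> S \<Longrightarrow> f t \<noteq> 0"
  obtains \<epsilon> :: real where "\<epsilon> = 1 \<or> \<epsilon> = -1" "\<And>t. t \<in> S \<Longrightarrow> \<epsilon> * f t > 0"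
proof -
  have iv: "is_interval (f ` S)"
    using connected_continuous_image[OF assms(2)] assms(1)
    by (simp add: is_interval_connected_1)
  show thesis
  proof (cases "\<exists>t\<in>S. f t > 0")
    case True
    then obtain a where a: "a \<in> S" "f a > 0" by auto
    have "f t > 0" if "t \<in> S" for t
    proof (rule ccontr)
      assume "\<not> f t > 0"
      then have "0 \<in> f ` S"
        using a that by (rule_tac mem_is_interval_1_I[OF iv imageI[of t] imageI[of a]]) auto
      then show False using assms(3) by auto
    qed
    then show thesis using that[of 1] by simp
  next
    case False
    have "f t < 0" if "t \<in> S" for t
      using False assms(3)[OF that] that by (metis linorder_neqE_linordered_idom)
    then show thesis using that[of "-1"] by simp
  qed
qed

text \<open>Integrating factor: for an antiderivative \<open>g\<close> of \<open>a\<close> the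
  product \<open>f * exp (- g)\<close> is constant, and it vanishes at \<open>s\<close>.\<close>

lemma linear_ode_zero:
  fixes f :: "real \<Rightarrow> real"
  assumes S: "is_interval S" and a: "continuous_on S a"
    and f: "\<And>t. t \<in> S \<Longrightarrow> (f has_real_derivative a t * f t) (at t within S)"
    and "s \<in> S" "f s = 0" "t \<in> S"
  shows "f t = 0"
proof -
  \<comment> \<open>The compact segment joining the two points is enough, and the continuous
    \<open>a\<close> has an antiderivative on it.\<close>
  define K where "K = {min s t..max s t}"
  have K: "K \<subseteq> S"
  proof
    fix x assume "x \<in> K"
    then show "x \<in> S"
      using assms(4,6) unfolding K_def
      by (rule_tac mem_is_interval_1_I[OF S, of "min s t" "max s t"]) (auto simp: min_def max_def)
  qed
  obtain g where g: "\<And>x. x \<in> K \<Longrightarrow> (g has_vector_derivative a x) (at x within K)"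
    using antiderivative_continuous[OF continuous_on_subset[OF a K, unfolded K_def]]
    unfolding K_def by metis
  have "\<exists>c. \<forall>x\<in>K. f x * exp (- g x) = c"
  proof (rule has_field_derivative_zero_constant)
    show "convex K" by (simp add: K_def)
    show "((\<lambda>x. f x * exp (- g x)) has_real_derivative 0) (at x within K)" if "x \<in> K" for x
    proof -
      have "(f has_real_derivative a x * f x) (at x within K)"
        using DERIV_subset[OF f K] K that by blast
      moreover have "(g has_real_derivative a x) (at x within K)"
        using g[OF that] by (simp add: has_real_derivative_iff_has_vector_derivative)
      ultimately show ?thesis by (auto intro!: derivative_eq_intros)
    qed
  qed
  then obtain c where c: "\<And>x. x \<in> K \<Longrightarrow> f x * exp (- g x) = c" by blast
  have "f t * exp (- g t) = f s * exp (- g s)"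
    using c[of s] c[of t] by (simp add: K_def)
  then show ?thesis using assms(5) by simp
qed

subsection \<open>Arc-length curves\<close>

lemma bounded_linear_Jrot: "bounded_linear Jrot"
proof -
  have "linear Jrot" by (rule linearI) auto
  then show ?thesis by (simp add: linear_conv_bounded_linear)
qed

lemma inner_Jrot: "inner z (Jrot z) = 0" "inner w (Jrot (Jrot z)) = - inner w z"
  by (cases z; cases w; simp add: inner_Pair)+

text \<open>\<open>z\<close> and \<open>Jrot z\<close> form an orthonormal basis. For
  \<open>z\<close> the unit tangent and \<open>w\<close> its derivative, the coefficient is the
  curvature.\<close>

lemma orthogonal_unit_Jrot:
  assumes "norm z = 1" "inner z w = 0"
  shows "w = inner w (Jrot z) *\<^sub>R Jrot z"
proof -
  obtain a b where z: "z = (a, b)" by (cases z)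
  obtain c d where w: "w = (c, d)" by (cases w)
  have "a * a + b * b = 1"
    using assms(1) by (simp add: z norm_Pair power2_eq_square)
  moreover have "a * c + b * d = 0" using assms(2) by (simp add: z w inner_Pair)
  ultimately have "c = (d * a - c * b) * (- b)" "d = (d * a - c * b) * a" by algebra+
  then show ?thesis by (simp add: z w inner_Pair)
qed

text \<open>\<open>\<sigma>\<close> is an arc-length function; the derivative of its inverse is the
  reciprocal of the speed of \<open>\<beta>\<close>, so the composite has unit speed.\<close>

lemma arc_length_reparamI:
  assumes \<beta>: "regular_curve \<beta> S" and \<sigma>: "smooth_on_interval S \<sigma>"
    and speed: "\<And>t. t \<in> S \<Longrightarrow> deriv_on S \<sigma> t = norm (deriv_on S \<beta> t)"
  shows "arc_length_reparam \<beta> S (\<lambda>s. \<beta> (inv_into S \<sigma> s)) (\<sigma> ` S)"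
proof -
  define g where "g = inv_into S \<sigma>"
  define L where "L = \<sigma> ` S"
  have S: "nondegenerate_interval S" and \<beta>s: "smooth_on_interval S \<beta>"
    and nz: "\<And>t. t \<in> S \<Longrightarrow> deriv_on S \<beta> t \<noteq> 0 \<and> \<beta> t \<noteq> 0"
    using \<beta> by (auto simp: regular_curve_def)
  have rep: "reparametrization \<sigma> S L"
    unfolding L_def using S \<sigma> speed nz by (intro reparametrizationI) auto
  have L: "nondegenerate_interval L" and bij: "bij_betw \<sigma> S L"
    using rep by (auto simp: reparametrization_def)
  have gS: "g s \<in> S" if "s \<in> L" for s
    using that unfolding g_def L_def by (rule inv_into_into)
  have g\<sigma>: "g (\<sigma> t) = t" if "t \<in> S" for t
    using that bij unfolding g_def by (rule bij_betw_inv_into_left[rotated])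
  note g = reparametrization_inverse[OF rep, folded g_def]
  have d: "((\<lambda>s. \<beta> (g s)) has_vector_derivative
      (1 / norm (deriv_on S \<beta> (g s))) *\<^sub>R deriv_on S \<beta> (g s)) (at s within L)" if "s \<in> L" for s
  proof -
    have "(\<beta> has_vector_derivative deriv_on S \<beta> (g s)) (at (g s) within g ` L)"
      using smooth_on_intervalD(1)[OF \<beta>s gS[OF that]]
      by (rule has_vector_derivative_within_subset) (use gS in auto)
    moreover have "(g has_vector_derivative 1 / norm (deriv_on S \<beta> (g s))) (at s within L)"
      using g(2)[OF that] speed[OF gS[OF that]]
      by (simp add: has_real_derivative_iff_has_vector_derivative)
    ultimately show ?thesis
      using vector_diff_chain_within[of g _ s L \<beta>] by (simp add: o_def)
  qed
  have dL: "deriv_on L (\<lambda>s. \<beta> (g s)) s =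
      (1 / norm (deriv_on S \<beta> (g s))) *\<^sub>R deriv_on S \<beta> (g s)" if "s \<in> L" for s
    using deriv_on_eqI[OF L that d[OF that]] .
  have "ndiff n L (\<lambda>s. \<beta> (g s))" for n
    using \<beta>s g(1) gS
    by (intro ndiff_compose[of n S \<beta> L g])
       (auto simp: smooth_on_interval_iff_ndiff[OF S] smooth_on_interval_iff_ndiff[OF L])
  then have "smooth_on_interval L (\<lambda>s. \<beta> (g s))"
    using smooth_on_interval_iff_ndiff[OF L] by blast
  then have "arc_length_curve (\<lambda>s. \<beta> (g s)) L"
    unfolding arc_length_curve_def regular_curve_def using L dL nz gS by simp
  moreover have "orientation_preserving \<sigma> S"
    unfolding orientation_preserving_def using speed nz by simp
  ultimately show ?thesis
    unfolding arc_length_reparam_def using rep g\<sigma> unfolding L_def g_def by metis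
qed

text \<open>The Frenet equations \<open>T' = \<kappa> N\<close> and
  \<open>N' = - \<kappa> T\<close>, paired with the position vector; the summand 1 is
  \<open>inner T T\<close>.\<close>

lemma arc_length_curve_frame:
  assumes "arc_length_curve \<alpha> L" and s: "s \<in> L"
  shows "((\<lambda>s. inner (\<alpha> s) (deriv_on L \<alpha> s)) has_real_derivative
           1 + curvature L \<alpha> s * inner (\<alpha> s) (unit_normal L \<alpha> s)) (at s within L)" (is ?t)
    and "((\<lambda>s. inner (\<alpha> s) (unit_normal L \<alpha> s)) has_real_derivative
           - curvature L \<alpha> s * inner (\<alpha> s) (deriv_on L \<alpha> s)) (at s within L)" (is ?n)
proof -
  define T where "T = deriv_on L \<alpha>"
  define T' where "T' = deriv_on L T"
  have L: "nondegenerate_interval L" and sm: "smooth_on_interval L \<alpha>"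
    and unit: "\<And>s. s \<in> L \<Longrightarrow> norm (T s) = 1"
    using assms(1) by (auto simp: arc_length_curve_def regular_curve_def T_def)
  have d\<alpha>: "(\<alpha> has_vector_derivative T s) (at s within L)"
    using smooth_on_intervalD(1)[OF sm s] by (simp add: T_def)
  have dT: "(T has_vector_derivative T' s) (at s within L)"
    using smooth_on_intervalD(1)[OF smooth_on_intervalD(2)[OF sm] s] by (simp add: T_def T'_def)
  \<comment> \<open>Differentiating the constant \<open>inner T T\<close> shows that
    \<open>T'\<close> is orthogonal to \<open>T\<close>, hence a multiple of the normal.\<close>
  have "((\<lambda>s. inner (T s) (T s)) has_vector_derivative inner (T s) (T' s) + inner (T' s) (T s))
      (at s within L)"
    by (rule bounded_bilinear.has_vector_derivative[OF bounded_bilinear_inner dT dT])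
  moreover have "((\<lambda>s. inner (T s) (T s)) has_vector_derivative 0) (at s within L)"
    by (rule has_vector_derivative_transform[OF s _ has_vector_derivative_const[of 1]])
       (use unit in \<open>simp add: norm_eq_1\<close>)
  ultimately have "inner (T s) (T' s) + inner (T' s) (T s) = 0"
    using vector_derivative_unique_within at_within_nondegenerate_interval[OF L s] by blast
  then have "inner (T s) (T' s) = 0" by (simp add: inner_commute)
  from orthogonal_unit_Jrot[OF unit[OF s] this]
  have T': "T' s = curvature L \<alpha> s *\<^sub>R Jrot (T s)"
    by (simp add: curvature_def unit_normal_def T_def T'_def)
  have J: "Jrot (c *\<^sub>R z) = c *\<^sub>R Jrot z" for c z
    by (rule linear_scale[OF bounded_linear.linear[OF bounded_linear_Jrot]])
  have "((\<lambda>s. inner (\<alpha> s) (T s)) has_vector_derivative inner (\<alpha> s) (T' s) + inner (T s) (T s))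
      (at s within L)"
    by (rule bounded_bilinear.has_vector_derivative[OF bounded_bilinear_inner d\<alpha> dT])
  moreover have "inner (\<alpha> s) (T' s) + inner (T s) (T s) =
      1 + curvature L \<alpha> s * inner (\<alpha> s) (Jrot (T s))"
    using unit[OF s] by (simp add: T' norm_eq_1)
  ultimately show ?t
    by (simp add: has_real_derivative_iff_has_vector_derivative T_def unit_normal_def)
  have "((\<lambda>s. inner (\<alpha> s) (Jrot (T s))) has_vector_derivative
      inner (\<alpha> s) (Jrot (T' s)) + inner (T s) (Jrot (T s))) (at s within L)"
    by (rule bounded_bilinear.has_vector_derivative[OF bounded_bilinear_inner d\<alpha>
          bounded_linear.has_vector_derivative[OF bounded_linear_Jrot dT]])
  moreover have "inner (\<alpha> s) (Jrot (T' s)) + inner (T s) (Jrot (T s)) =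
      - curvature L \<alpha> s * inner (\<alpha> s) (T s)"
    by (simp add: T' J inner_Jrot)
  ultimately show ?n
    by (simp add: has_real_derivative_iff_has_vector_derivative T_def unit_normal_def)
qed

lemma arc_length_curve_norm:
  assumes "arc_length_curve \<alpha> L" "s \<in> L"
  shows "(norm (\<alpha> s))\<^sup>2 = (inner (\<alpha> s) (deriv_on L \<alpha> s))\<^sup>2 + (inner (\<alpha> s) (unit_normal L \<alpha> s))\<^sup>2"
proof -
  obtain x y where z: "\<alpha> s = (x, y)" by (cases "\<alpha> s")
  obtain a b where w: "deriv_on L \<alpha> s = (a, b)" by (cases "deriv_on L \<alpha> s")
  have "norm (a, b) = 1" using assms w by (auto simp: arc_length_curve_def)
  then have "a\<^sup>2 + b\<^sup>2 = 1" by (simp add: norm_Pair)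
  then have "x\<^sup>2 + y\<^sup>2 = (x * a + y * b)\<^sup>2 + (x * (- b) + y * a)\<^sup>2" by algebra
  then show ?thesis by (simp add: z w unit_normal_def norm_Pair inner_Pair)
qed

lemma ndiff_inner_plane:
  fixes f g :: "real \<Rightarrow> plane"
  assumes "ndiff n S f" "ndiff n S g"
  shows "ndiff n S (\<lambda>t. inner (f t) (g t))"
  unfolding inner_prod_def inner_real_def
  by (intro ndiff_add ndiff_mult ndiff_bounded_linear[OF bounded_linear_fst assms(1)]
      ndiff_bounded_linear[OF bounded_linear_snd assms(1)]
      ndiff_bounded_linear[OF bounded_linear_fst assms(2)]
      ndiff_bounded_linear[OF bounded_linear_snd assms(2)])

text \<open>Permits differentiating an identity known only on \<open>S\<close>, endpoints
  included.\<close>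

lemma zero_derivative_if_constant:
  fixes f :: "real \<Rightarrow> real"
  assumes "nondegenerate_interval S" "s \<in> S" "\<And>t. t \<in> S \<Longrightarrow> f t = c"
    and "(f has_real_derivative d) (at s within S)"
  shows "d = 0"
proof -
  have "(f has_vector_derivative 0) (at s within S)"
    by (rule has_vector_derivative_transform[OF assms(2) _ has_vector_derivative_const[of c]])
       (use assms(3) in simp)
  then show ?thesis
    using vector_derivative_unique_within[OF at_within_nondegenerate_interval[OF assms(1,2)]]
      assms(4) by (auto simp: has_real_derivative_iff_has_vector_derivative)
qed

lemma collinear_plane_normal:
  fixes P :: "plane set"
  assumes "collinear P" "z0 \<in> P"
  obtains a b d where "(a, b) \<noteq> (0, 0)" "\<And>x y. (x, y) \<in> P \<Longrightarrow> a * x + b * y = d"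
proof -
  obtain u :: plane where u: "\<And>x y. x \<in> P \<Longrightarrow> y \<in> P \<Longrightarrow> \<exists>c. x - y = c *\<^sub>R u"
    using assms(1) unfolding collinear_def by blast
  obtain u1 u2 where u12: "u = (u1, u2)" by (cases u)
  obtain x0 y0 where z0: "z0 = (x0, y0)" by (cases z0)
  \<comment> \<open>A normal to the direction \<open>u\<close>. If \<open>u = 0\<close> the set is a
    single point and any nonzero normal will do.\<close>
  define a b where "a = (if u = 0 then 1 else - u2)" and "b = (if u = 0 then 0 else u1)"
  have ab: "a * u1 + b * u2 = 0" "(a, b) \<noteq> (0, 0)"
    by (auto simp: a_def b_def u12 zero_prod_def)
  have "a * x + b * y = a * x0 + b * y0" if xy: "(x, y) \<in> P" for x y
  proof -
    obtain c where "(x, y) - (x0, y0) = c *\<^sub>R u" using u[OF xy] assms(2) z0 by blast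
    then have "x = x0 + c * u1" "y = y0 + c * u2" by (auto simp: u12)
    then have "a * x + b * y = a * x0 + b * y0 + c * (a * u1 + b * u2)" by algebra
    then show ?thesis using ab(1) by simp
  qed
  then show thesis using that ab(2) by blast
qed

subsection \<open>The explicit family\<close>

text \<open>The hypotheses of the theorem, bundled so that it follows by interpretation.\<close>

locale ramp_family =
  fixes v \<mu> A B :: real and r \<Theta> :: "real \<Rightarrow> real" and \<alpha> :: "real \<Rightarrow> plane" and I :: "real set"
  assumes v_pos: "v > 0" and v_neq_1: "v \<noteq> 1" and mu_pos: "\<mu> > 0"
    and B_eq: "B = \<mu> * (v\<^sup>2 - 1)" and A_eq: "A = 1 + B\<^sup>2"
    and r_eq: "\<And>\<phi>. r \<phi> = exp (- (\<mu> * v\<^sup>2 * \<phi> / A)) *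
                     (1 / (cos \<phi> + B * sin \<phi>)) powr (\<mu> * v\<^sup>2 * B / A)"
    and \<Theta>_eq: "\<And>\<phi>. \<Theta> \<phi> = \<mu> * v\<^sup>2 * (B * \<phi> - ln (B * sin \<phi> + cos \<phi>)) / (B\<^sup>2 + 1)"
    and \<alpha>_eq: "\<And>\<phi>. \<alpha> \<phi> = r \<phi> *\<^sub>R (- cos (\<Theta> \<phi>), sin (\<Theta> \<phi>))"
    and I_eq: "I = {arctan B - pi / 2 <..< arctan B + pi / 2}"
begin

text \<open>\<open>D\<close> is the common denominator of the logarithmic derivative of
  \<open>r\<close>, which is \<open>- k cos / D\<close>, and of the derivative of
  \<open>\<Theta>\<close>, which is \<open>k sin / D\<close>.\<close>

definition D :: "real \<Rightarrow> real" where "D \<phi> = cos \<phi> + B * sin \<phi>"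
definition k :: real where "k = \<mu> * v\<^sup>2"

lemma k_eq: "k = B + \<mu>"
  by (simp add: k_def B_eq algebra_simps)

lemma k_pos: "k > 0"
  using v_pos mu_pos by (simp add: k_def)

lemma A_pos: "A > 0"
  by (simp add: A_eq add_pos_nonneg)

lemma B_neq_0: "B \<noteq> 0"
proof
  assume "B = 0"
  then have "v\<^sup>2 = 1" using mu_pos by (simp add: B_eq)
  then show False using v_pos v_neq_1 by (simp add: power2_eq_1_iff)
qed

section \<open>The interval on which \<open>D\<close> is positive\<close>

lemma cos_arctan_B_pos: "cos (arctan B) > 0"
  by (simp add: cos_arctan add_pos_nonneg)

lemma sin_arctan_B: "sin (arctan B) = B * cos (arctan B)"
  by (simp add: sin_arctan cos_arctan)

text \<open>As \<open>B\<close> is the tangent of \<open>arctan B\<close>, \<open>D\<close> is a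
  cosine shifted by \<open>arctan B\<close> up to a positive factor. Its zeros and its sign are read
  off from this.\<close>

lemma D_shift: "cos (arctan B) * D (arctan B + \<theta>) = cos \<theta>"
proof -
  have "cos (arctan B) * D (arctan B + \<theta>) =
      cos \<theta> * ((cos (arctan B))\<^sup>2 + (B * cos (arctan B)) * sin (arctan B))
      + sin \<theta> * (cos (arctan B) * (B * cos (arctan B)) - cos (arctan B) * sin (arctan B))"
    by (simp add: D_def cos_add sin_add algebra_simps power2_eq_square)
  also have "\<dots> = cos \<theta> * ((cos (arctan B))\<^sup>2 + (sin (arctan B))\<^sup>2)"
    by (simp add: sin_arctan_B power2_eq_square)
  finally show ?thesis by simp
qed

lemma D_pos: "\<phi> \<in> I \<Longrightarrow> D \<phi> > 0"
proof -
  assume "\<phi> \<in> I"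
  then have "cos (\<phi> - arctan B) > 0" by (intro cos_gt_zero_pi) (auto simp: I_eq)
  then have "cos (arctan B) * D \<phi> > 0" using D_shift[of "\<phi> - arctan B"] by simp
  then show ?thesis using cos_arctan_B_pos by (simp add: zero_less_mult_iff)
qed

text \<open>\<open>D\<close> vanishes at \<open>arctan B - pi / 2\<close> and
  \<open>arctan B + pi / 2\<close>, so the interval contains neither. Since 0 lies between these two
  points, so does the whole interval, and its length \<open>pi\<close> forces equality.\<close>

lemma interval_of_positivity:
  "b - a = pi \<and> 0 \<in> {a<..<b} \<and> (\<forall>\<phi>\<in>{a<..<b}. cos \<phi> + B * sin \<phi> > 0)
     \<longleftrightarrow> a = arctan B - pi / 2 \<and> b = arctan B + pi / 2"
proof
  assume *: "b - a = pi \<and> 0 \<in> {a<..<b} \<and> (\<forall>\<phi>\<in>{a<..<b}. cos \<phi> + B * sin \<phi> > 0)"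
  have D0: "\<not> D (arctan B + \<theta>) > 0" if "cos \<theta> = 0" for \<theta>
    using D_shift[of \<theta>] cos_arctan_B_pos that by simp
  have "cos (- (pi / 2)) = 0" "cos (pi / 2) = 0" by simp_all
  note D0[OF this(1)] D0[OF this(2)]
  then have "\<not> (a < arctan B - pi / 2 \<and> arctan B - pi / 2 < b)"
    "\<not> (a < arctan B + pi / 2 \<and> arctan B + pi / 2 < b)"
    using * unfolding D_def by auto
  then show "a = arctan B - pi / 2 \<and> b = arctan B + pi / 2"
    using * arctan_bounded[of B] by (auto simp: field_simps)
next
  assume *: "a = arctan B - pi / 2 \<and> b = arctan B + pi / 2"
  then show "b - a = pi \<and> 0 \<in> {a<..<b} \<and> (\<forall>\<phi>\<in>{a<..<b}. cos \<phi> + B * sin \<phi> > 0)"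
    using arctan_bounded[of B] D_pos by (auto simp: I_eq D_def field_simps)
qed

section \<open>Derivatives of \<open>r\<close>, \<open>\<Theta>\<close> and the rotated, dilated
  curve\<close>

lemma open_I: "open I"
  by (simp add: I_eq)

lemma r_pos: "\<phi> \<in> I \<Longrightarrow> r \<phi> > 0"
  using D_pos[of \<phi>] by (simp add: r_eq D_def)

lemma r_eq_exp: "\<phi> \<in> I \<Longrightarrow> r \<phi> = exp (- (k * \<phi> / A) - k * B / A * ln (D \<phi>))"
  using D_pos[of \<phi>] by (simp add: r_eq k_def D_def powr_def ln_div exp_diff exp_minus field_simps)

lemma \<Theta>_eq_ln: "\<Theta> \<phi> = k * (B * \<phi> - ln (D \<phi>)) / A"
  by (simp add: \<Theta>_eq k_def D_def A_eq add.commute)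

lemma D_deriv: "(D has_real_derivative B * cos \<phi> - sin \<phi>) (at \<phi> within S)"
  unfolding D_def by (auto intro!: derivative_eq_intros)

lemma r_deriv:
  assumes "\<phi> \<in> I"
  shows "(r has_real_derivative - k * r \<phi> * cos \<phi> / D \<phi>) (at \<phi>)"
proof -
  have "((\<lambda>\<phi>. exp (- (k * \<phi> / A) - k * B / A * ln (D \<phi>))) has_real_derivative
      (- (k / A) - k * B / A * ((B * cos \<phi> - sin \<phi>) / D \<phi>)) * r \<phi>) (at \<phi>)"
    using D_pos[OF assms] A_pos
    by (auto intro!: derivative_eq_intros D_deriv simp: r_eq_exp[OF assms] ac_simps)
  moreover have "(- (k / A) - k * B / A * ((B * cos \<phi> - sin \<phi>) / D \<phi>)) = - k * cos \<phi> / D \<phi>"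
  proof -
    \<comment> \<open>The identity \<open>D + B D' = A cos\<close> cancels the denominator
      \<open>A\<close>.\<close>
    have "D \<phi> + B * (B * cos \<phi> - sin \<phi>) = A * cos \<phi>"
      by (simp add: D_def A_eq algebra_simps power2_eq_square)
    then have "(- (k / A) - k * B / A * ((B * cos \<phi> - sin \<phi>) / D \<phi>)) = - k * (A * cos \<phi>) / (A * D \<phi>)"
      using D_pos[OF assms] A_pos by (simp add: field_simps flip: distrib_left) algebra
    then show ?thesis using A_pos by simp
  qed
  ultimately have "((\<lambda>\<phi>. exp (- (k * \<phi> / A) - k * B / A * ln (D \<phi>))) has_real_derivative
      - k * r \<phi> * cos \<phi> / D \<phi>) (at \<phi>)" by (simp add: mult.commute mult.left_commute)
  then show ?thesis
    by (rule has_field_derivative_transform_within_open[OF _ open_I assms])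
       (simp add: r_eq_exp)
qed

lemma \<Theta>_deriv:
  assumes "\<phi> \<in> I"
  shows "(\<Theta> has_real_derivative k * sin \<phi> / D \<phi>) (at \<phi>)"
proof -
  have "((\<lambda>\<phi>. k * (B * \<phi> - ln (D \<phi>)) / A) has_real_derivative
      k * (B - (B * cos \<phi> - sin \<phi>) / D \<phi>) / A) (at \<phi>)"
    using D_pos[OF assms] A_pos by (auto intro!: derivative_eq_intros D_deriv)
  moreover have "k * (B - (B * cos \<phi> - sin \<phi>) / D \<phi>) / A = k * sin \<phi> / D \<phi>"
  proof -
    \<comment> \<open>The companion identity \<open>B D - D' = A sin\<close>.\<close>
    have "B * D \<phi> - (B * cos \<phi> - sin \<phi>) = A * sin \<phi>"
      by (simp add: D_def A_eq algebra_simps power2_eq_square)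
    then show ?thesis using D_pos[OF assms] A_pos by (simp add: field_simps)
  qed
  ultimately show ?thesis unfolding \<Theta>_eq_ln by simp
qed

lemma ndiff_D: "ndiff n I D"
  unfolding D_def by (intro ndiff_intros)

lemma ndiff_\<Theta>: "ndiff n I \<Theta>"
  unfolding \<Theta>_eq_ln using A_pos
  by (intro ndiff_divide ndiff_intros ndiff_ln ndiff_D D_pos) auto

lemma ndiff_r: "ndiff n I r"
proof (rule ndiff_cong)
  show "ndiff n I (\<lambda>\<phi>. exp (- (k * \<phi> / A) - k * B / A * ln (D \<phi>)))" using A_pos
    by (intro ndiff_intros ndiff_divide ndiff_ln ndiff_D D_pos) auto
qed (simp add: r_eq_exp)

text \<open>In complex notation the rotated, dilated curve is
  \<open>- c r e^(i (\<omega> - \<Theta>))\<close>.\<close>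

lemma rotation_\<alpha>:
  "c *\<^sub>R rotation \<omega> (\<alpha> \<phi>) = (- (c * r \<phi> * cos (\<omega> - \<Theta> \<phi>)), - (c * r \<phi> * sin (\<omega> - \<Theta> \<phi>)))"
  by (simp add: \<alpha>_eq cos_diff sin_diff algebra_simps)

text \<open>In complex notation \<open>r' - i r \<Theta>' = - (k r / D) e^(i \<phi>)\<close>. Hence,
  for increasing \<open>\<phi>\<close>, the parameter is the angle from the inward radial direction
  to the velocity.\<close>

lemma rotation_\<alpha>_deriv:
  assumes "(\<phi> has_real_derivative \<phi>') (at s within S)" "\<phi> s \<in> I"
  shows "((\<lambda>s. c *\<^sub>R rotation \<omega> (\<alpha> (\<phi> s))) has_vector_derivative
     (c * k * r (\<phi> s) * \<phi>' / D (\<phi> s)) *\<^sub>R (cos (\<omega> - \<Theta> (\<phi> s) + \<phi> s), sin (\<omega> - \<Theta> (\<phi> s) + \<phi> s)))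
     (at s within S)"
proof -
  define \<psi> where "\<psi> = \<omega> - \<Theta> (\<phi> s)"
  have D: "D (\<phi> s) \<noteq> 0" using D_pos[OF assms(2)] by simp
  have r: "((\<lambda>s. r (\<phi> s)) has_real_derivative (- k * r (\<phi> s) * cos (\<phi> s) / D (\<phi> s)) * \<phi>') (at s within S)"
    by (rule DERIV_chain2[OF r_deriv[OF assms(2)] assms(1)])
  have \<Theta>: "((\<lambda>s. \<Theta> (\<phi> s)) has_real_derivative (k * sin (\<phi> s) / D (\<phi> s)) * \<phi>') (at s within S)"
    by (rule DERIV_chain2[OF \<Theta>_deriv[OF assms(2)] assms(1)])
  have "((\<lambda>s. - (c * r (\<phi> s) * cos (\<omega> - \<Theta> (\<phi> s)))) has_real_derivative
      c * k * r (\<phi> s) * \<phi>' / D (\<phi> s) * cos (\<psi> + \<phi> s)) (at s within S)"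
    by (rule derivative_eq_intros refl r \<Theta>)+ (use D in \<open>simp add: \<psi>_def[symmetric] cos_add field_simps\<close>)
  moreover have "((\<lambda>s. - (c * r (\<phi> s) * sin (\<omega> - \<Theta> (\<phi> s)))) has_real_derivative
      c * k * r (\<phi> s) * \<phi>' / D (\<phi> s) * sin (\<psi> + \<phi> s)) (at s within S)"
    by (rule derivative_eq_intros refl r \<Theta>)+ (use D in \<open>simp add: \<psi>_def[symmetric] sin_add field_simps\<close>)
  ultimately show ?thesis
    unfolding rotation_\<alpha> \<psi>_def scaleR_Pair real_scaleR_def
    by (intro has_vector_derivative_Pair) (simp_all add: has_real_derivative_iff_has_vector_derivative)
qed

text \<open>\<open>\<epsilon>\<close> is the sign of the derivative of \<open>\<phi>\<close>, and
  the unit tangent is \<open>\<epsilon> (cos \<psi>, sin \<psi>)\<close>. The ramp equation then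
  reduces to \<open>D - k sin = cos - \<mu> sin\<close>, that is, to
  \<open>k = B + \<mu>\<close>.\<close>

lemma ramp_of_angle:
  assumes arc: "arc_length_curve \<gamma> L" and \<phi>: "smooth_on_interval L \<phi>"
    and nz: "\<And>s. s \<in> L \<Longrightarrow> deriv_on L \<phi> s \<noteq> 0" and \<phi>I: "\<And>s. s \<in> L \<Longrightarrow> \<phi> s \<in> I"
    and c: "c > 0" and \<gamma>: "\<And>s. s \<in> L \<Longrightarrow> \<gamma> s = c *\<^sub>R rotation \<omega> (\<alpha> (\<phi> s))"
  obtains \<epsilon> :: real where "\<epsilon> = 1 \<or> \<epsilon> = -1"
    and "\<And>s. s \<in> L \<Longrightarrow> inner (\<gamma> s) (deriv_on L \<gamma> s) = - \<epsilon> * c * r (\<phi> s) * cos (\<phi> s)"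
    and "\<And>s. s \<in> L \<Longrightarrow> inner (\<gamma> s) (unit_normal L \<gamma> s) = \<epsilon> * c * r (\<phi> s) * sin (\<phi> s)"
    and "\<And>s. s \<in> L \<Longrightarrow> curvature L \<gamma> s = - (1 / (v\<^sup>2 * (norm (\<gamma> s))\<^sup>2)) *
             (inner (\<gamma> s) (deriv_on L \<gamma> s) / \<mu> + inner (\<gamma> s) (unit_normal L \<gamma> s))"
proof -
  define \<phi>' where "\<phi>' = deriv_on L \<phi>"
  define \<psi> where "\<psi> s = \<omega> - \<Theta> (\<phi> s) + \<phi> s" for s
  have L: "nondegenerate_interval L" and unit: "\<And>s. s \<in> L \<Longrightarrow> norm (deriv_on L \<gamma> s) = 1"
    using arc by (auto simp: arc_length_curve_def regular_curve_def)
  have d\<phi>: "(\<phi> has_real_derivative \<phi>' s) (at s within L)" if "s \<in> L" for s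
    using smooth_on_intervalD(1)[OF \<phi> that]
    by (simp add: \<phi>'_def has_real_derivative_iff_has_vector_derivative)
  obtain \<epsilon> :: real where \<epsilon>: "\<epsilon> = 1 \<or> \<epsilon> = -1" and pos: "\<And>s. s \<in> L \<Longrightarrow> \<epsilon> * \<phi>' s > 0"
    using nonzero_constant_sign[of L \<phi>'] L nz
      smooth_on_interval_continuous[OF smooth_on_intervalD(2)[OF \<phi>]]
    unfolding \<phi>'_def nondegenerate_interval_def by metis
  have \<epsilon>2: "\<epsilon> * \<epsilon> = 1" using \<epsilon> by auto
  have dT: "deriv_on L \<gamma> s = (c * k * r (\<phi> s) * \<phi>' s / D (\<phi> s)) *\<^sub>R (cos (\<psi> s), sin (\<psi> s))"
    if s: "s \<in> L" for s
  proof (rule deriv_on_eqI[OF L s])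
    show "(\<gamma> has_vector_derivative (c * k * r (\<phi> s) * \<phi>' s / D (\<phi> s)) *\<^sub>R (cos (\<psi> s), sin (\<psi> s)))
        (at s within L)"
      unfolding \<psi>_def
      by (rule has_vector_derivative_transform[OF s _ rotation_\<alpha>_deriv[OF d\<phi>[OF s] \<phi>I[OF s]]])
         (simp add: \<gamma>)
  qed
  \<comment> \<open>Unit speed gives this factor absolute value 1, and it has the sign of
    \<open>\<phi>'\<close> because \<open>c\<close>, \<open>k\<close>, \<open>r\<close> and
    \<open>D\<close> are positive.\<close>
  have speed: "c * k * r (\<phi> s) * \<phi>' s / D (\<phi> s) = \<epsilon>" if s: "s \<in> L" for s
  proof -
    define w where "w = c * k * r (\<phi> s) * \<phi>' s / D (\<phi> s)"
    have "\<bar>w\<bar> = 1"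
      using unit[OF s] unfolding dT[OF s] w_def[symmetric] norm_scaleR norm_Pair by simp
    moreover have "\<epsilon> * w = (\<epsilon> * \<phi>' s) * (c * k * r (\<phi> s) / D (\<phi> s))"
      by (simp add: w_def)
    then have "\<epsilon> * w > 0"
      using pos[OF s] c k_pos r_pos[OF \<phi>I[OF s]] D_pos[OF \<phi>I[OF s]] by simp
    ultimately have "w = \<epsilon>" using \<epsilon> by auto
    then show ?thesis by (simp add: w_def)
  qed
  have T: "deriv_on L \<gamma> s = \<epsilon> *\<^sub>R (cos (\<psi> s), sin (\<psi> s))" if "s \<in> L" for s
    using dT[OF that] speed[OF that] by simp
  have N: "unit_normal L \<gamma> s = \<epsilon> *\<^sub>R (- sin (\<psi> s), cos (\<psi> s))" if "s \<in> L" for s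
    using T[OF that] by (simp add: unit_normal_def)
  have \<gamma>': "\<gamma> s = (- (c * r (\<phi> s) * cos (\<psi> s - \<phi> s)), - (c * r (\<phi> s) * sin (\<psi> s - \<phi> s)))"
    if "s \<in> L" for s
    using \<gamma>[OF that] by (simp add: rotation_\<alpha> \<psi>_def)
  have X: "inner (\<gamma> s) (deriv_on L \<gamma> s) = - \<epsilon> * c * r (\<phi> s) * cos (\<phi> s)" if s: "s \<in> L" for s
  proof -
    have "inner (\<gamma> s) (deriv_on L \<gamma> s) = - \<epsilon> * c * r (\<phi> s) *
        (cos (\<psi> s) * cos (\<psi> s - \<phi> s) + sin (\<psi> s) * sin (\<psi> s - \<phi> s))"
      by (simp add: \<gamma>'[OF s] T[OF s] inner_Pair algebra_simps)
    also have "cos (\<psi> s) * cos (\<psi> s - \<phi> s) + sin (\<psi> s) * sin (\<psi> s - \<phi> s) = cos (\<phi> s)"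
      by (simp flip: cos_diff)
    finally show ?thesis .
  qed
  have Y: "inner (\<gamma> s) (unit_normal L \<gamma> s) = \<epsilon> * c * r (\<phi> s) * sin (\<phi> s)" if s: "s \<in> L" for s
  proof -
    have "inner (\<gamma> s) (unit_normal L \<gamma> s) = \<epsilon> * c * r (\<phi> s) *
        (sin (\<psi> s) * cos (\<psi> s - \<phi> s) - cos (\<psi> s) * sin (\<psi> s - \<phi> s))"
      by (simp add: \<gamma>'[OF s] N[OF s] inner_Pair algebra_simps)
    also have "sin (\<psi> s) * cos (\<psi> s - \<phi> s) - cos (\<psi> s) * sin (\<psi> s - \<phi> s) = sin (\<phi> s)"
      by (simp flip: sin_diff)
    finally show ?thesis .
  qed
  have \<kappa>: "curvature L \<gamma> s = - (1 / (v\<^sup>2 * (norm (\<gamma> s))\<^sup>2)) *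
             (inner (\<gamma> s) (deriv_on L \<gamma> s) / \<mu> + inner (\<gamma> s) (unit_normal L \<gamma> s))" if s: "s \<in> L" for s
  proof -
    define \<psi>' where "\<psi>' = (1 - k * sin (\<phi> s) / D (\<phi> s)) * \<phi>' s"
    have Dp: "D (\<phi> s) > 0" and rp: "r (\<phi> s) > 0" using D_pos r_pos \<phi>I[OF s] by auto
    have "((\<lambda>s. \<Theta> (\<phi> s)) has_real_derivative (k * sin (\<phi> s) / D (\<phi> s)) * \<phi>' s) (at s within L)"
      by (rule DERIV_chain2[OF \<Theta>_deriv[OF \<phi>I[OF s]] d\<phi>[OF s]])
    then have d\<psi>: "(\<psi> has_real_derivative \<psi>') (at s within L)"
      unfolding \<psi>_def \<psi>'_def
      by (auto intro!: derivative_eq_intros d\<phi>[OF s] simp: algebra_simps)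
    have "((\<lambda>s. (\<epsilon> * cos (\<psi> s), \<epsilon> * sin (\<psi> s))) has_vector_derivative
        (- \<epsilon> * \<psi>' * sin (\<psi> s), \<epsilon> * \<psi>' * cos (\<psi> s))) (at s within L)"
      by (intro has_vector_derivative_Pair)
         (auto intro!: derivative_eq_intros d\<psi> simp flip: has_real_derivative_iff_has_vector_derivative)
    then have "(deriv_on L \<gamma> has_vector_derivative
        (- \<epsilon> * \<psi>' * sin (\<psi> s), \<epsilon> * \<psi>' * cos (\<psi> s))) (at s within L)"
      by (rule has_vector_derivative_transform[OF s, rotated]) (simp add: T)
    from deriv_on_eqI[OF L s this]
    have "curvature L \<gamma> s = (\<epsilon> * \<psi>' * sin (\<psi> s)) * (\<epsilon> * sin (\<psi> s))
        + (\<epsilon> * \<psi>' * cos (\<psi> s)) * (\<epsilon> * cos (\<psi> s))"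
      unfolding curvature_def N[OF s] by (simp add: inner_Pair)
    \<comment> \<open>Curvature is the turning rate of the tangent angle \<open>\<psi>\<close>;
      \<open>\<epsilon>\<close> enters squared, so orientation does not matter.\<close>
    then have \<kappa>: "curvature L \<gamma> s = \<psi>'"
      using \<epsilon>2 sin_cos_squared_add[of "\<psi> s"] by algebra
    have \<phi>': "\<phi>' s = \<epsilon> * D (\<phi> s) / (c * k * r (\<phi> s))"
      using speed[OF s] Dp rp c k_pos by (simp add: field_simps)
    have \<psi>': "\<psi>' = \<epsilon> * (D (\<phi> s) - k * sin (\<phi> s)) / (c * k * r (\<phi> s))"
      unfolding \<psi>'_def \<phi>' using Dp rp c k_pos by (simp add: field_simps)
    have Dk: "D (\<phi> s) - k * sin (\<phi> s) = cos (\<phi> s) - \<mu> * sin (\<phi> s)"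
      by (simp add: D_def k_eq algebra_simps)
    have nrm: "(norm (\<gamma> s))\<^sup>2 = (c * r (\<phi> s))\<^sup>2"
    proof -
      have "(norm (\<gamma> s))\<^sup>2 =
          (- \<epsilon> * c * r (\<phi> s) * cos (\<phi> s))\<^sup>2 + (\<epsilon> * c * r (\<phi> s) * sin (\<phi> s))\<^sup>2"
        by (simp only: arc_length_curve_norm[OF arc s] X[OF s] Y[OF s])
      then show ?thesis using \<epsilon>2 sin_cos_squared_add[of "\<phi> s"] by algebra
    qed
    have *: "curvature L \<gamma> s = \<epsilon> * (cos (\<phi> s) - \<mu> * sin (\<phi> s)) / (c * k * r (\<phi> s))"
      by (simp only: \<kappa> \<psi>' Dk)
    show ?thesis
      unfolding * nrm X[OF s] Y[OF s] k_def using Dp rp c mu_pos v_pos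
      by (simp add: field_simps power2_eq_square)
  qed
  from that[OF \<epsilon> X Y \<kappa>] show thesis by blast
qed

text \<open>\<open>c\<close> may be negative: the sign \<open>\<epsilon>\<close> of the orientation
  is absorbed into it.\<close>

lemma treadmill_not_collinear:
  assumes L: "nondegenerate_interval L" and \<phi>: "smooth_on_interval L \<phi>"
    and nz: "\<And>s. s \<in> L \<Longrightarrow> deriv_on L \<phi> s \<noteq> 0" and \<phi>I: "\<And>s. s \<in> L \<Longrightarrow> \<phi> s \<in> I"
    and c: "c \<noteq> 0"
  shows "\<not> collinear ((\<lambda>s. (c * r (\<phi> s) * cos (\<phi> s), - (c * r (\<phi> s) * sin (\<phi> s)))) ` L)"
proof
  assume col: "collinear ((\<lambda>s. (c * r (\<phi> s) * cos (\<phi> s), - (c * r (\<phi> s) * sin (\<phi> s)))) ` L)"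
  define \<phi>' where "\<phi>' = deriv_on L \<phi>"
  have d\<phi>: "(\<phi> has_real_derivative \<phi>' s) (at s within L)" if "s \<in> L" for s
    using smooth_on_intervalD(1)[OF \<phi> that]
    by (simp add: \<phi>'_def has_real_derivative_iff_has_vector_derivative)
  obtain s0 where s0: "s0 \<in> L"
    using L by (auto simp: nondegenerate_interval_iff)
  obtain a b d where ab: "(a, b) \<noteq> (0, 0)"
    and line: "\<And>s. s \<in> L \<Longrightarrow> a * (c * r (\<phi> s) * cos (\<phi> s)) + b * (- (c * r (\<phi> s) * sin (\<phi> s))) = d"
    using collinear_plane_normal[OF col imageI[OF s0]] by (metis (no_types, lifting) imageI)
  \<comment> \<open>The coefficients of the quadratic form left after differentiating the affine
    relation, dividing by \<open>c r \<phi>'\<close> and multiplying by \<open>D\<close>.\<close>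
  define P Q R where "P = - k * a - b" and "Q = k * b - a - b * B" and "R = - a * B"
  have H: "P * (cos (\<phi> s))\<^sup>2 + Q * sin (\<phi> s) * cos (\<phi> s) + R * (sin (\<phi> s))\<^sup>2 = 0" if s: "s \<in> L" for s
  proof -
    have Dp: "D (\<phi> s) > 0" and rp: "r (\<phi> s) > 0" using D_pos r_pos \<phi>I[OF s] by auto
    have dr: "((\<lambda>s. r (\<phi> s)) has_real_derivative (- k * r (\<phi> s) * cos (\<phi> s) / D (\<phi> s)) * \<phi>' s)
        (at s within L)"
      by (rule DERIV_chain2[OF r_deriv[OF \<phi>I[OF s]] d\<phi>[OF s]])
    have "((\<lambda>s. a * (c * r (\<phi> s) * cos (\<phi> s)) + b * (- (c * r (\<phi> s) * sin (\<phi> s)))) has_real_derivative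
        c * r (\<phi> s) * \<phi>' s * (- k * cos (\<phi> s) / D (\<phi> s) * (a * cos (\<phi> s) - b * sin (\<phi> s))
          - (a * sin (\<phi> s) + b * cos (\<phi> s)))) (at s within L)"
      by (rule derivative_eq_intros refl dr d\<phi>[OF s])+ (simp add: algebra_simps diff_divide_distrib)
    from zero_derivative_if_constant[OF L s line this]
    have "- k * cos (\<phi> s) / D (\<phi> s) * (a * cos (\<phi> s) - b * sin (\<phi> s))
          - (a * sin (\<phi> s) + b * cos (\<phi> s)) = 0"
      using c rp nz[OF s] by (simp add: \<phi>'_def)
    then have "- k * cos (\<phi> s) * (a * cos (\<phi> s) - b * sin (\<phi> s))
          - (a * sin (\<phi> s) + b * cos (\<phi> s)) * D (\<phi> s) = 0"
      using Dp by (simp add: field_simps)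
    then show ?thesis
      by (simp add: P_def Q_def R_def D_def algebra_simps power2_eq_square)
  qed
  \<comment> \<open>The derivative of the form:
    \<open>(R - P) sin (2 \<phi>) + Q cos (2 \<phi>) = 0\<close>.\<close>
  have M: "2 * (R - P) * sin (\<phi> s) * cos (\<phi> s) + Q * ((cos (\<phi> s))\<^sup>2 - (sin (\<phi> s))\<^sup>2) = 0"
    if s: "s \<in> L" for s
  proof -
    have "((\<lambda>s. P * (cos (\<phi> s))\<^sup>2 + Q * sin (\<phi> s) * cos (\<phi> s) + R * (sin (\<phi> s))\<^sup>2) has_real_derivative
       \<phi>' s * (2 * (R - P) * sin (\<phi> s) * cos (\<phi> s) + Q * ((cos (\<phi> s))\<^sup>2 - (sin (\<phi> s))\<^sup>2)))
       (at s within L)"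
      by (rule derivative_eq_intros refl d\<phi>[OF s])+ (simp add: algebra_simps power2_eq_square)
    from zero_derivative_if_constant[OF L s H this] show ?thesis
      using nz[OF s] by (simp add: \<phi>'_def)
  qed
  define S C where "S = sin (\<phi> s0)" and "C = cos (\<phi> s0)"
  have SC: "S\<^sup>2 + C\<^sup>2 = 1" by (simp add: S_def C_def)
  have 1: "2 * (R - P) * S * C + Q * (C\<^sup>2 - S\<^sup>2) = 0"
    using M[OF s0] by (simp add: S_def C_def)
  \<comment> \<open>A further derivative, at one point only, gives
    \<open>(R - P) cos (2 \<phi>) - Q sin (2 \<phi>) = 0\<close>.\<close>
  have "((\<lambda>s. 2 * (R - P) * sin (\<phi> s) * cos (\<phi> s) + Q * ((cos (\<phi> s))\<^sup>2 - (sin (\<phi> s))\<^sup>2))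
       has_real_derivative
       2 * \<phi>' s0 * ((R - P) * (C\<^sup>2 - S\<^sup>2) - Q * (2 * S * C))) (at s0 within L)"
    unfolding S_def C_def
    by (rule derivative_eq_intros refl d\<phi>[OF s0])+ (simp add: algebra_simps power2_eq_square)
  from zero_derivative_if_constant[OF L s0 M this]
  have 2: "(R - P) * (C\<^sup>2 - S\<^sup>2) - Q * (2 * S * C) = 0"
    using nz[OF s0] by (simp add: \<phi>'_def)
  \<comment> \<open>The equations \<open>1\<close> and \<open>2\<close> form a linear system for
    \<open>R - P\<close> and \<open>Q\<close> whose matrix is orthogonal, so both unknowns vanish.
    The form is then \<open>P (C^2 + S^2)\<close>, whence \<open>P = 0\<close>.\<close>
  have "R - P = 0" "Q = 0"
    using 1 2 SC by algebra+
  moreover have "P * C\<^sup>2 + Q * S * C + R * S\<^sup>2 = 0"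
    using H[OF s0] by (simp add: S_def C_def)
  ultimately have "P = 0" "R = 0" using SC by algebra+
  \<comment> \<open>\<open>R = - a B\<close> with \<open>B\<close> nonzero gives
    \<open>a = 0\<close>, and then \<open>P\<close> gives \<open>b = 0\<close>.\<close>
  then have "a = 0" "b = 0" using B_neq_0 by (auto simp: P_def R_def)
  then show False using ab by simp
qed

section \<open>The explicit curves are ramps with non-collinear TreadmillSled\<close>

lemma angle_of_arc_length_reparam:
  assumes T: "T \<subseteq> I" and h: "reparametrization h S T"
    and \<beta>: "\<And>t. t \<in> S \<Longrightarrow> \<beta> t = c *\<^sub>R rotation \<omega> (\<alpha> (h t))"
    and arc: "arc_length_reparam \<beta> S \<gamma> L"
  obtains \<phi> where "smooth_on_interval L \<phi>" "\<And>s. s \<in> L \<Longrightarrow> deriv_on L \<phi> s \<noteq> 0"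
    "\<And>s. s \<in> L \<Longrightarrow> \<phi> s \<in> I" "\<And>s. s \<in> L \<Longrightarrow> \<gamma> s = c *\<^sub>R rotation \<omega> (\<alpha> (\<phi> s))"
proof -
  obtain \<sigma> where \<sigma>: "reparametrization \<sigma> S L" "\<And>t. t \<in> S \<Longrightarrow> \<beta> t = \<gamma> (\<sigma> t)"
    using arc by (auto simp: arc_length_reparam_def)
  \<comment> \<open>The angle as a function of arc length is \<open>h\<close> after the inverse of
    \<open>\<sigma>\<close>.\<close>
  define \<tau> where "\<tau> = inv_into S \<sigma>"
  note \<tau> = reparametrization_inverse[OF \<sigma>(1), folded \<tau>_def]
  have S: "nondegenerate_interval S" and L: "nondegenerate_interval L" and \<sigma>S: "bij_betw \<sigma> S L"
    and hs: "smooth_on_interval S h" and hT: "bij_betw h S T"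
    and h0: "\<And>t. t \<in> S \<Longrightarrow> deriv_on S h t \<noteq> 0" and \<sigma>0: "\<And>t. t \<in> S \<Longrightarrow> deriv_on S \<sigma> t \<noteq> 0"
    using h \<sigma>(1) by (auto simp: reparametrization_def)
  have \<tau>S: "\<tau> s \<in> S" "\<sigma> (\<tau> s) = s" if "s \<in> L" for s
    using that \<sigma>S unfolding \<tau>_def
    by (simp_all add: bij_betw_inv_into_right bij_betwE[OF bij_betw_inv_into])
  have "ndiff n L (\<lambda>s. h (\<tau> s))" for n
    using hs \<tau>(1) \<tau>S
    by (intro ndiff_compose[of n S h L \<tau>])
       (auto simp: smooth_on_interval_iff_ndiff[OF S] smooth_on_interval_iff_ndiff[OF L])
  then have sm: "smooth_on_interval L (\<lambda>s. h (\<tau> s))"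
    using smooth_on_interval_iff_ndiff[OF L] by blast
  have nz: "deriv_on L (\<lambda>s. h (\<tau> s)) s \<noteq> 0" if s: "s \<in> L" for s
  proof -
    have 1: "(h has_vector_derivative deriv_on S h (\<tau> s)) (at (\<tau> s) within \<tau> ` L)"
      using smooth_on_intervalD(1)[OF hs \<tau>S(1)[OF s]]
      by (rule has_vector_derivative_within_subset) (use \<tau>S in auto)
    have 2: "(\<tau> has_vector_derivative 1 / deriv_on S \<sigma> (\<tau> s)) (at s within L)"
      using \<tau>(2)[OF s] by (simp add: has_real_derivative_iff_has_vector_derivative)
    from vector_diff_chain_within[OF 2 1] have "((\<lambda>s. h (\<tau> s)) has_vector_derivative
        (1 / deriv_on S \<sigma> (\<tau> s)) * deriv_on S h (\<tau> s)) (at s within L)"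
      by (simp add: o_def)
    from deriv_on_eqI[OF L s this] show ?thesis
      using h0[OF \<tau>S(1)[OF s]] \<sigma>0[OF \<tau>S(1)[OF s]] by simp
  qed
  show thesis
  proof (rule that[OF sm nz])
    fix s assume s: "s \<in> L"
    show "h (\<tau> s) \<in> I" using bij_betwE[OF hT] \<tau>S(1)[OF s] T by blast
    show "\<gamma> s = c *\<^sub>R rotation \<omega> (\<alpha> (h (\<tau> s)))"
      using \<beta>[OF \<tau>S(1)[OF s]] \<sigma>(2)[OF \<tau>S(1)[OF s]] \<tau>S(2)[OF s] by simp
  qed
qed

text \<open>The speed of \<open>\<beta>\<close> is \<open>c k r / D\<close> at \<open>h t\<close>
  times the absolute value of \<open>h' t\<close>. So an antiderivative of \<open>c k r / D\<close>
  on \<open>I\<close>, composed with \<open>h\<close> and given the sign of \<open>h'\<close>, is an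
  arc-length function.\<close>

lemma arc_length_reparam_exists:
  assumes c: "c > 0" and T: "T \<subseteq> I" and h: "reparametrization h S T"
    and \<beta>: "\<And>t. t \<in> S \<Longrightarrow> \<beta> t = c *\<^sub>R rotation \<omega> (\<alpha> (h t))"
  obtains \<gamma> L where "regular_curve \<beta> S" "arc_length_reparam \<beta> S \<gamma> L"
proof -
  define h' where "h' = deriv_on S h"
  have S: "nondegenerate_interval S" and hs: "smooth_on_interval S h" and hT: "bij_betw h S T"
    and h0: "\<And>t. t \<in> S \<Longrightarrow> h' t \<noteq> 0"
    using h by (auto simp: reparametrization_def h'_def)
  have hI: "h t \<in> I" if "t \<in> S" for t
    using bij_betwE[OF hT] that T by blast
  have dh: "(h has_real_derivative h' t) (at t within S)" if "t \<in> S" for t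
    using smooth_on_intervalD(1)[OF hs that]
    by (simp add: h'_def has_real_derivative_iff_has_vector_derivative)
  have hn: "ndiff n S h" for n
    using hs smooth_on_interval_iff_ndiff[OF S] by blast
  have comp: "ndiff n S (\<lambda>t. f (h t))" if "ndiff n I f" for n and f :: "real \<Rightarrow> real"
    using ndiff_compose[OF that hn] hI by blast
  have d\<beta>: "deriv_on S \<beta> t = (c * k * r (h t) * h' t / D (h t)) *\<^sub>R
      (cos (\<omega> - \<Theta> (h t) + h t), sin (\<omega> - \<Theta> (h t) + h t))" if t: "t \<in> S" for t
    by (rule deriv_on_eqI[OF S t has_vector_derivative_transform[OF t _
          rotation_\<alpha>_deriv[OF dh[OF t] hI[OF t]]]]) (rule \<beta>)
  have "ndiff n S \<beta>" for n
  proof (rule ndiff_cong)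
    show "ndiff n S (\<lambda>t. (- (c * r (h t) * cos (\<omega> - \<Theta> (h t))), - (c * r (h t) * sin (\<omega> - \<Theta> (h t)))))"
      by (intro ndiff_intros comp ndiff_r ndiff_\<Theta>)
  qed (simp add: \<beta> rotation_\<alpha>)
  then have "smooth_on_interval S \<beta>"
    using smooth_on_interval_iff_ndiff[OF S] by blast
  moreover have unit: "norm (cos x, sin x) = 1" for x :: real
    by (simp add: norm_Pair)
  have "\<beta> t \<noteq> 0 \<and> deriv_on S \<beta> t \<noteq> 0" if t: "t \<in> S" for t
  proof -
    have "\<beta> t = (- (c * r (h t))) *\<^sub>R (cos (\<omega> - \<Theta> (h t)), sin (\<omega> - \<Theta> (h t)))"
      using \<beta>[OF t] by (simp add: rotation_\<alpha>)
    moreover have "(cos x, sin x) \<noteq> 0" for x :: real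
      using unit[of x] by (metis norm_zero zero_neq_one)
    ultimately show ?thesis
      unfolding d\<beta>[OF t] using c k_pos r_pos[OF hI[OF t]] D_pos[OF hI[OF t]] h0[OF t]
      by (simp del: scaleR_Pair)
  qed
  ultimately have reg: "regular_curve \<beta> S"
    using S by (simp add: regular_curve_def)
  have "isCont (\<lambda>x. c * k * r x / D x) x" if x: "x \<in> I" for x
    using D_pos[OF x] DERIV_isCont[OF r_deriv[OF x]] DERIV_isCont[OF D_deriv]
    by (intro continuous_intros) auto
  then obtain g where g: "\<And>x. x \<in> I \<Longrightarrow> (g has_vector_derivative c * k * r x / D x) (at x)"
    using einterval_antiderivative[of "ereal (arctan B - pi / 2)" "ereal (arctan B + pi / 2)"
        "\<lambda>x. c * k * r x / D x"]
    by (auto simp: I_eq)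
  have gn: "ndiff n I g" for n
  proof (rule ndiff_SucD, rule ndiff_SucI)
    show "(g has_vector_derivative c * k * r x / D x) (at x within I)" if "x \<in> I" for x
      using g[OF that] by (rule has_vector_derivative_at_within)
    show "ndiff n I (\<lambda>x. c * k * r x / D x)"
      by (intro ndiff_divide ndiff_intros ndiff_r ndiff_D) (auto dest: D_pos)
  qed
  obtain \<epsilon> :: real where \<epsilon>: "\<epsilon> = 1 \<or> \<epsilon> = -1" and pos: "\<And>t. t \<in> S \<Longrightarrow> \<epsilon> * h' t > 0"
    using nonzero_constant_sign[of S h'] S h0
      smooth_on_interval_continuous[OF smooth_on_intervalD(2)[OF hs]]
    unfolding h'_def nondegenerate_interval_def by metis
  \<comment> \<open>The factor \<open>\<epsilon>\<close> makes \<open>\<sigma>\<close> increasing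
    even when \<open>h\<close> reverses the orientation.\<close>
  define \<sigma> where "\<sigma> t = \<epsilon> * g (h t)" for t
  have "smooth_on_interval S \<sigma>"
    unfolding smooth_on_interval_iff_ndiff[OF S] \<sigma>_def
    by (intro allI ndiff_mult ndiff_const comp gn)
  moreover have "deriv_on S \<sigma> t = norm (deriv_on S \<beta> t)" if t: "t \<in> S" for t
  proof -
    have "(g has_real_derivative c * k * r (h t) / D (h t)) (at (h t))"
      using g[OF hI[OF t]] by (simp add: has_real_derivative_iff_has_vector_derivative)
    from DERIV_cmult[OF DERIV_chain2[OF this dh[OF t]], of \<epsilon>]
    have "(\<sigma> has_vector_derivative \<epsilon> * (c * k * r (h t) / D (h t) * h' t)) (at t within S)"
      unfolding \<sigma>_def by (simp add: has_real_derivative_iff_has_vector_derivative)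
    then have "deriv_on S \<sigma> t = (c * k * r (h t) / D (h t)) * (\<epsilon> * h' t)"
      using deriv_on_eqI[OF S t] by force
    also have "\<epsilon> * h' t = \<bar>h' t\<bar>" using \<epsilon> pos[OF t] by auto
    also have "(c * k * r (h t) / D (h t)) * \<bar>h' t\<bar> = norm (deriv_on S \<beta> t)"
      unfolding d\<beta>[OF t] norm_scaleR unit
      using c k_pos r_pos[OF hI[OF t]] D_pos[OF hI[OF t]] by (simp add: abs_mult)
    finally show ?thesis .
  qed
  ultimately show thesis
    using arc_length_reparamI[OF reg] that[OF reg] by blast
qed

lemma ramp_of_parametrization:
  assumes c: "c > 0" and T: "T \<subseteq> I" and h: "reparametrization h S T"
    and \<beta>: "\<And>t. t \<in> S \<Longrightarrow> \<beta> t = c *\<^sub>R rotation \<omega> (\<alpha> (h t))"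
  shows "constant_speed_ramp v \<mu> \<beta> S" and "\<not> treadmill_sled_in_line \<beta> S"
proof -
  \<comment> \<open>Stated for every arc-length reparametrization, since the negation of
    \<open>treadmill_sled_in_line\<close> has to exclude all of them; the ramp equation takes one
    instance.\<close>
  have key: "(\<forall>s\<in>L. curvature L \<gamma> s = - (1 / (v\<^sup>2 * (norm (\<gamma> s))\<^sup>2)) *
             (inner (\<gamma> s) (deriv_on L \<gamma> s) / \<mu> + inner (\<gamma> s) (unit_normal L \<gamma> s)))
       \<and> \<not> collinear (treadmill_sled L \<gamma> ` L)"
    if arc: "arc_length_reparam \<beta> S \<gamma> L" for \<gamma> L
  proof -
    obtain \<phi> where \<phi>: "smooth_on_interval L \<phi>" "\<And>s. s \<in> L \<Longrightarrow> deriv_on L \<phi> s \<noteq> 0"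
      "\<And>s. s \<in> L \<Longrightarrow> \<phi> s \<in> I" "\<And>s. s \<in> L \<Longrightarrow> \<gamma> s = c *\<^sub>R rotation \<omega> (\<alpha> (\<phi> s))"
      using angle_of_arc_length_reparam[OF T h \<beta> arc] by blast
    have curve: "arc_length_curve \<gamma> L" using arc by (simp add: arc_length_reparam_def)
    obtain \<epsilon> :: real where \<epsilon>: "\<epsilon> = 1 \<or> \<epsilon> = -1"
      and X: "\<And>s. s \<in> L \<Longrightarrow> inner (\<gamma> s) (deriv_on L \<gamma> s) = - \<epsilon> * c * r (\<phi> s) * cos (\<phi> s)"
      and Y: "\<And>s. s \<in> L \<Longrightarrow> inner (\<gamma> s) (unit_normal L \<gamma> s) = \<epsilon> * c * r (\<phi> s) * sin (\<phi> s)"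
      and \<kappa>: "\<And>s. s \<in> L \<Longrightarrow> curvature L \<gamma> s = - (1 / (v\<^sup>2 * (norm (\<gamma> s))\<^sup>2)) *
             (inner (\<gamma> s) (deriv_on L \<gamma> s) / \<mu> + inner (\<gamma> s) (unit_normal L \<gamma> s))"
      using ramp_of_angle[OF curve \<phi>(1,2,3) c \<phi>(4)] by blast
    have "treadmill_sled L \<gamma> ` L =
        (\<lambda>s. (\<epsilon> * c * r (\<phi> s) * cos (\<phi> s), - (\<epsilon> * c * r (\<phi> s) * sin (\<phi> s)))) ` L"
      by (rule image_cong) (simp_all add: treadmill_sled_def X Y)
    moreover have "nondegenerate_interval L"
      using curve by (simp add: arc_length_curve_def regular_curve_def)
    ultimately show ?thesis
      using treadmill_not_collinear[of L \<phi> "\<epsilon> * c"] \<phi> \<epsilon> c \<kappa> by auto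
  qed
  then show "\<not> treadmill_sled_in_line \<beta> S"
    unfolding treadmill_sled_in_line_def by blast
  obtain \<gamma> L where reg: "regular_curve \<beta> S" and arc: "arc_length_reparam \<beta> S \<gamma> L"
    using arc_length_reparam_exists[OF c T h \<beta>] by blast
  show "constant_speed_ramp v \<mu> \<beta> S"
    unfolding constant_speed_ramp_def using reg key[OF arc] arc by blast
qed

section \<open>Recovering the explicit parametrization from a ramp\<close>

lemma parametrization_of_ramp:
  assumes arc: "arc_length_curve \<gamma> L"
    and \<kappa>: "\<And>s. s \<in> L \<Longrightarrow> curvature L \<gamma> s = - (1 / (v\<^sup>2 * (norm (\<gamma> s))\<^sup>2)) *
             (inner (\<gamma> s) (deriv_on L \<gamma> s) / \<mu> + inner (\<gamma> s) (unit_normal L \<gamma> s))"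
    and not_line: "\<not> collinear (treadmill_sled L \<gamma> ` L)"
  obtains \<phi> c \<omega> where "c > 0" "smooth_on_interval L \<phi>" "\<And>s. s \<in> L \<Longrightarrow> deriv_on L \<phi> s \<noteq> 0"
    "\<And>s. s \<in> L \<Longrightarrow> \<phi> s \<in> I" "\<And>s. s \<in> L \<Longrightarrow> \<gamma> s = c *\<^sub>R rotation \<omega> (\<alpha> (\<phi> s))"
proof -
  define X where "X s = inner (\<gamma> s) (deriv_on L \<gamma> s)" for s
  define Y where "Y s = inner (\<gamma> s) (unit_normal L \<gamma> s)" for s
  define j where "j s = 1 / (k * ((X s)\<^sup>2 + (Y s)\<^sup>2))" for s
  \<comment> \<open>On the explicit curve \<open>X = - \<epsilon> c r cos \<phi>\<close> and
    \<open>Y = \<epsilon> c r sin \<phi>\<close>, so \<open>E = \<epsilon> c r D\<close>, and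
    \<open>F / E\<close> is the tangent of \<open>\<phi> - arctan B\<close>.\<close>
  define E where "E s = B * Y s - X s" for s
  define F where "F s = Y s + B * X s" for s
  define K where "K = curvature L \<gamma>"
  have L: "nondegenerate_interval L" and smooth: "smooth_on_interval L \<gamma>"
    and nz: "\<And>s. s \<in> L \<Longrightarrow> \<gamma> s \<noteq> 0"
    using arc by (auto simp: arc_length_curve_def regular_curve_def)
  have iL: "is_interval L" using L by (simp add: nondegenerate_interval_def)
  have XY: "(norm (\<gamma> s))\<^sup>2 = (X s)\<^sup>2 + (Y s)\<^sup>2" "(X s)\<^sup>2 + (Y s)\<^sup>2 > 0" if "s \<in> L" for s
  proof -
    show *: "(norm (\<gamma> s))\<^sup>2 = (X s)\<^sup>2 + (Y s)\<^sup>2"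
      using arc_length_curve_norm[OF arc that] by (simp add: X_def Y_def)
    show "(X s)\<^sup>2 + (Y s)\<^sup>2 > 0" using nz[OF that] by (simp flip: *)
  qed
  \<comment> \<open>Together with the next fact this puts the ramp equation into polynomial form;
    the identities below follow from the two relations.\<close>
  have j: "(B + \<mu>) * ((X s)\<^sup>2 + (Y s)\<^sup>2) * j s = 1" if "s \<in> L" for s
    using XY(2)[OF that] k_pos by (auto simp: j_def simp flip: k_eq)
  have K: "K s = - ((X s + \<mu> * Y s) * j s)" if "s \<in> L" for s
    using \<kappa>[OF that] XY[OF that] mu_pos v_pos
    unfolding K_def j_def k_def X_def[symmetric] Y_def[symmetric]
    by (simp add: field_simps)
  have dX: "(X has_real_derivative 1 + K s * Y s) (at s within L)" if "s \<in> L" for s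
    using arc_length_curve_frame(1)[OF arc that] unfolding X_def Y_def K_def .
  have dY: "(Y has_real_derivative - K s * X s) (at s within L)" if "s \<in> L" for s
    using arc_length_curve_frame(2)[OF arc that] unfolding X_def Y_def K_def .
  have dE: "(E has_real_derivative - (Y s - \<mu> * X s) * j s * E s) (at s within L)" if s: "s \<in> L" for s
  proof -
    have "(E has_real_derivative B * (- K s * X s) - (1 + K s * Y s)) (at s within L)"
      unfolding E_def by (auto intro!: derivative_eq_intros dX[OF s] dY[OF s])
    \<comment> \<open>Once \<open>K\<close> is substituted, the summand 1 is replaced by
      \<open>(B + \<mu>) (X^2 + Y^2) j\<close>, and the rest factors through
      \<open>E\<close>.\<close>
    moreover have "B * (- K s * X s) - (1 + K s * Y s) = - (Y s - \<mu> * X s) * j s * E s"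
      using K[OF s] j[OF s] unfolding E_def by algebra
    ultimately show ?thesis by simp
  qed
  have cX: "continuous_on L X" and cY: "continuous_on L Y"
    using dX dY by (meson DERIV_continuous continuous_on_eq_continuous_within)+
  have E0: "E s \<noteq> 0" if s: "s \<in> L" for s
  proof
    assume "E s = 0"
    have "continuous_on L (\<lambda>s. - (Y s - \<mu> * X s) * j s)"
      unfolding j_def using XY(2) k_pos
      by (intro continuous_intros cX cY) (metis less_irrefl mult_eq_0_iff)
    from linear_ode_zero[OF iL this dE s \<open>E s = 0\<close>] have X: "X t = B * Y t" if "t \<in> L" for t
      using that by (simp add: E_def)
    have "collinear (treadmill_sled L \<gamma> ` L)"
      unfolding collinear_def
    \<comment> \<open>The direction comes from \<open>X = B Y\<close>.\<close>
    proof (rule exI[of _ "(B, 1)"], intro ballI)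
      fix z w assume "z \<in> treadmill_sled L \<gamma> ` L" "w \<in> treadmill_sled L \<gamma> ` L"
      then obtain a b where "a \<in> L" "z = - (X a, Y a)" "b \<in> L" "w = - (X b, Y b)"
        by (auto simp: treadmill_sled_def X_def Y_def)
      then have "z - w = (Y b - Y a) *\<^sub>R (B, 1)"
        using X by (simp add: algebra_simps)
      then show "\<exists>c. z - w = c *\<^sub>R (B, 1)" by blast
    qed
    then show False using not_line by contradiction
  qed
  \<comment> \<open>The range of \<open>arctan\<close> places the angle in \<open>I\<close> for
    either sign of \<open>E\<close>.\<close>
  define \<phi> where "\<phi> s = arctan B + arctan (F s / E s)" for s
  have \<phi>I: "\<phi> s \<in> I" for s
    using arctan_bounded[of "F s / E s"] by (auto simp: \<phi>_def I_eq)
  \<comment> \<open>Quotients by \<open>D\<close> are independent of the sign of \<open>E\<close>,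
    and they are all that the derivatives of \<open>r\<close> and \<open>\<Theta>\<close>
    involve.\<close>
  have \<phi>: "cos (\<phi> s) / D (\<phi> s) = - X s / E s" "sin (\<phi> s) / D (\<phi> s) = Y s / E s" if s: "s \<in> L" for s
  proof -
    \<comment> \<open>A common factor of the cosine, the sine and \<open>D\<close>; it cancels in
      the quotients.\<close>
    define u where "u = cos (arctan B) * cos (arctan (F s / E s))"
    have sn: "sin (arctan (F s / E s)) = F s / E s * cos (arctan (F s / E s))"
      by (simp add: sin_arctan cos_arctan)
    have 1: "cos (\<phi> s) = u * (1 - B * (F s / E s))" "sin (\<phi> s) = u * (B + F s / E s)"
      unfolding \<phi>_def cos_add sin_add sn sin_arctan_B u_def by (simp_all add: algebra_simps)
    have "cos (\<phi> s) * E s = u * (E s - B * F s)" "sin (\<phi> s) * E s = u * (B * E s + F s)"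
      using E0[OF s] by (simp_all add: 1 field_simps)
    moreover have "D (\<phi> s) = u * (1 + B\<^sup>2)"
      unfolding D_def 1 by (simp add: algebra_simps power2_eq_square)
    ultimately have "cos (\<phi> s) * E s = - X s * D (\<phi> s)" "sin (\<phi> s) * E s = Y s * D (\<phi> s)"
      unfolding E_def F_def by algebra+
    moreover have "D (\<phi> s) \<noteq> 0" using D_pos[OF \<phi>I[of s]] by simp
    ultimately show "cos (\<phi> s) / D (\<phi> s) = - X s / E s" "sin (\<phi> s) / D (\<phi> s) = Y s / E s"
      using E0[OF s] by (metis frac_eq_eq)+
  qed
  have d\<phi>: "(\<phi> has_real_derivative E s * j s) (at s within L)" if s: "s \<in> L" for s
  proof -
    define E' where "E' = B * (- K s * X s) - (1 + K s * Y s)"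
    define F' where "F' = - K s * X s + B * (1 + K s * Y s)"
    have "(E has_real_derivative E') (at s within L)"
      unfolding E_def E'_def by (auto intro!: derivative_eq_intros dX[OF s] dY[OF s])
    moreover have "(F has_real_derivative F') (at s within L)"
      unfolding F_def F'_def by (auto intro!: derivative_eq_intros dX[OF s] dY[OF s])
    ultimately have "((\<lambda>s. F s / E s) has_real_derivative (F' * E s - F s * E') / (E s * E s)) (at s within L)"
      using DERIV_divide E0[OF s] by blast
    from DERIV_add[OF DERIV_const[of "arctan B"] DERIV_chain2[OF DERIV_arctan this]]
    have "(\<phi> has_real_derivative
        inverse (1 + (F s / E s)\<^sup>2) * ((F' * E s - F s * E') / (E s * E s))) (at s within L)"
      unfolding \<phi>_def by simp
    moreover have "1 + (F s / E s)\<^sup>2 = ((E s)\<^sup>2 + (F s)\<^sup>2) / (E s * E s)"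
      using E0[OF s] by (simp add: power_divide add_divide_distrib power2_eq_square)
    then have "inverse (1 + (F s / E s)\<^sup>2) * ((F' * E s - F s * E') / (E s * E s))
        = (F' * E s - F s * E') / ((E s)\<^sup>2 + (F s)\<^sup>2)"
      using E0[OF s] by simp
    \<comment> \<open>The left side is \<open>(1 + B^2) (X' Y - X Y')\<close> with
      \<open>X' Y - X Y' = Y + K (X^2 + Y^2) = E / k\<close>, and
      \<open>E^2 + F^2 = (1 + B^2) (X^2 + Y^2)\<close>.\<close>
    moreover have "F' * E s - F s * E' = E s * j s * ((E s)\<^sup>2 + (F s)\<^sup>2)"
      using K[OF s] j[OF s] unfolding E_def F_def E'_def F'_def by algebra
    moreover have "(E s)\<^sup>2 + (F s)\<^sup>2 \<noteq> 0"
      using E0[OF s] by (simp add: sum_power2_eq_zero_iff)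
    ultimately show ?thesis using E0[OF s] by simp
  qed
  have smX: "ndiff n L X" and smY: "ndiff n L Y" for n
    unfolding X_def Y_def unit_normal_def
    using smooth smooth_on_intervalD(2)[OF smooth] smooth_on_interval_iff_ndiff[OF L]
    by (auto intro!: ndiff_inner_plane ndiff_bounded_linear[OF bounded_linear_Jrot])
  have "ndiff n L \<phi>" for n
    unfolding \<phi>_def using E0 unfolding E_def F_def
    by (intro ndiff_intros ndiff_arctan ndiff_divide smX smY) auto
  then have sm\<phi>: "smooth_on_interval L \<phi>"
    using smooth_on_interval_iff_ndiff[OF L] by blast
  have \<phi>nz: "deriv_on L \<phi> s \<noteq> 0" if s: "s \<in> L" for s
  proof -
    have "deriv_on L \<phi> s = E s * j s"
      using d\<phi>[OF s] by (intro deriv_on_eqI[OF L s]) (simp add: has_real_derivative_iff_has_vector_derivative)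
    moreover have "j s \<noteq> 0" using j[OF s] by auto
    ultimately show ?thesis using E0[OF s] by simp
  qed
  define x y where "x s = fst (\<gamma> s)" and "y s = snd (\<gamma> s)" for s
  define i where "i s = k * j s" for s
  \<comment> \<open>Solving the definitions of \<open>X\<close> and \<open>Y\<close> for the tangent
    gives \<open>\<gamma>' = (X \<gamma> - Y J \<gamma>) / |\<gamma>|^2\<close>; the function
    \<open>i\<close> is \<open>1 / |\<gamma>|^2\<close>, not the imaginary unit.\<close>
  have dxy: "(x has_real_derivative (X s * x s + Y s * y s) * i s) (at s within L)"
    "(y has_real_derivative (X s * y s - Y s * x s) * i s) (at s within L)" if s: "s \<in> L" for s
  proof -
    obtain a b where T: "deriv_on L \<gamma> s = (a, b)" by (cases "deriv_on L \<gamma> s")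
    have "norm (a, b) = 1" using arc s T by (auto simp: arc_length_curve_def)
    then have ab: "a\<^sup>2 + b\<^sup>2 = 1" by (simp add: norm_Pair)
    have g: "\<gamma> s = (x s, y s)" by (simp add: x_def y_def)
    have XYs: "X s = x s * a + y s * b" "Y s = - x s * b + y s * a"
      unfolding X_def Y_def unit_normal_def T g by (simp_all add: inner_Pair)
    have i: "((X s)\<^sup>2 + (Y s)\<^sup>2) * i s = 1"
      using j[OF s] by (simp add: i_def k_eq ac_simps)
    have "a = (X s * x s + Y s * y s) * i s" "b = (X s * y s - Y s * x s) * i s"
      using i ab unfolding XYs by algebra+
    moreover have "(\<gamma> has_vector_derivative (a, b)) (at s within L)"
      using smooth_on_intervalD(1)[OF smooth s] T by simp
    from bounded_linear.has_vector_derivative[OF bounded_linear_fst this]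
      bounded_linear.has_vector_derivative[OF bounded_linear_snd this]
    have "(x has_real_derivative a) (at s within L)" "(y has_real_derivative b) (at s within L)"
      unfolding x_def y_def by (simp_all add: has_real_derivative_iff_has_vector_derivative)
    ultimately show "(x has_real_derivative (X s * x s + Y s * y s) * i s) (at s within L)"
      "(y has_real_derivative (X s * y s - Y s * x s) * i s) (at s within L)" by simp_all
  qed
  \<comment> \<open>Multiplying by \<open>q\<close> cancels the radial rate
    \<open>X / |\<gamma>|^2\<close> of the curve, and turning by \<open>\<theta>\<close> cancels its
    angular rate \<open>- Y / |\<gamma>|^2\<close>.\<close>
  define q where "q s = inverse (r (\<phi> s))" for s
  define \<theta> where "\<theta> s = \<Theta> (\<phi> s)" for s
  have dq: "(q has_real_derivative - X s * i s * q s) (at s within L)" if s: "s \<in> L" for s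
  proof -
    have r0: "r (\<phi> s) \<noteq> 0" using r_pos[OF \<phi>I[of s]] by simp
    have "((\<lambda>s. r (\<phi> s)) has_real_derivative - k * r (\<phi> s) * cos (\<phi> s) / D (\<phi> s) * (E s * j s))
        (at s within L)"
      by (rule DERIV_chain2[OF r_deriv[OF \<phi>I] d\<phi>[OF s]])
    also have "- k * r (\<phi> s) * cos (\<phi> s) / D (\<phi> s) * (E s * j s)
        = - k * r (\<phi> s) * (cos (\<phi> s) / D (\<phi> s)) * (E s * j s)" by simp
    also have "\<dots> = X s * i s * r (\<phi> s)"
      unfolding \<phi>(1)[OF s] i_def using E0[OF s] by simp
    finally have "((\<lambda>s. r (\<phi> s)) has_real_derivative X s * i s * r (\<phi> s)) (at s within L)" .
    from DERIV_inverse_fun[OF this r0]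
    have "(q has_real_derivative - (X s * i s * r (\<phi> s) * inverse (r (\<phi> s) ^ Suc (Suc 0)))) (at s within L)"
      unfolding q_def .
    also have "- (X s * i s * r (\<phi> s) * inverse (r (\<phi> s) ^ Suc (Suc 0))) = - X s * i s * q s"
      using r0 by (simp add: q_def)
    finally show ?thesis .
  qed
  have d\<theta>: "(\<theta> has_real_derivative Y s * i s) (at s within L)" if s: "s \<in> L" for s
  proof -
    have "(\<theta> has_real_derivative k * sin (\<phi> s) / D (\<phi> s) * (E s * j s)) (at s within L)"
      unfolding \<theta>_def by (rule DERIV_chain2[OF \<Theta>_deriv[OF \<phi>I] d\<phi>[OF s]])
    also have "k * sin (\<phi> s) / D (\<phi> s) * (E s * j s) = k * (sin (\<phi> s) / D (\<phi> s)) * (E s * j s)" by simp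
    also have "\<dots> = Y s * i s"
      unfolding \<phi>(2)[OF s] i_def using E0[OF s] by simp
    finally show ?thesis .
  qed
  have "convex L" using iL by (simp add: is_interval_convex_1)
  \<comment> \<open>This constant and the next are the real and imaginary parts of the complex
    quotient of \<open>\<gamma>\<close> by the explicit curve at \<open>\<phi>\<close>.\<close>
  have "\<exists>m. \<forall>s\<in>L. - (x s * cos (\<theta> s) - y s * sin (\<theta> s)) * q s = m"
    by (rule has_field_derivative_zero_constant[OF \<open>convex L\<close>],
        (rule derivative_eq_intros refl dxy dq d\<theta> | assumption)+)
       (simp add: algebra_simps)
  then obtain m1 where m1: "\<And>s. s \<in> L \<Longrightarrow> - (x s * cos (\<theta> s) - y s * sin (\<theta> s)) * q s = m1" by blast
  have "\<exists>m. \<forall>s\<in>L. - (x s * sin (\<theta> s) + y s * cos (\<theta> s)) * q s = m"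
    by (rule has_field_derivative_zero_constant[OF \<open>convex L\<close>],
        (rule derivative_eq_intros refl dxy dq d\<theta> | assumption)+)
       (simp add: algebra_simps)
  then obtain m2 where m2: "\<And>s. s \<in> L \<Longrightarrow> - (x s * sin (\<theta> s) + y s * cos (\<theta> s)) * q s = m2" by blast
  have xy: "x s = - r (\<phi> s) * (m1 * cos (\<theta> s) + m2 * sin (\<theta> s))"
    "y s = - r (\<phi> s) * (m2 * cos (\<theta> s) - m1 * sin (\<theta> s))" if s: "s \<in> L" for s
  proof -
    have "r (\<phi> s) * q s = 1" using r_pos[OF \<phi>I[of s]] by (simp add: q_def)
    then show "x s = - r (\<phi> s) * (m1 * cos (\<theta> s) + m2 * sin (\<theta> s))"
      "y s = - r (\<phi> s) * (m2 * cos (\<theta> s) - m1 * sin (\<theta> s))"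
      using m1[OF s] m2[OF s] sin_cos_squared_add[of "\<theta> s"] by algebra+
  qed
  \<comment> \<open>The polar form of the constant quotient: its modulus \<open>c\<close> is the
    dilation and its argument \<open>\<omega>\<close> the rotation. It is nonzero because
    \<open>\<gamma>\<close> avoids the origin.\<close>
  define c where "c = sqrt (m1\<^sup>2 + m2\<^sup>2)"
  obtain s0 where s0: "s0 \<in> L" using L by (auto simp: nondegenerate_interval_iff)
  have "m1 \<noteq> 0 \<or> m2 \<noteq> 0"
    using xy[OF s0] nz[OF s0] by (auto simp: x_def y_def prod_eq_iff)
  then have m: "m1\<^sup>2 + m2\<^sup>2 > 0" by (simp add: sum_power2_gt_zero_iff)
  then have c: "c > 0" "c\<^sup>2 = m1\<^sup>2 + m2\<^sup>2" by (simp_all add: c_def)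
  have "(m1 / c)\<^sup>2 + (m2 / c)\<^sup>2 = 1"
    using m by (auto simp: power_divide c(2) simp flip: add_divide_distrib)
  then obtain \<omega> where "m1 / c = cos \<omega>" "m2 / c = sin \<omega>"
    using sincos_total_2pi by metis
  then have \<omega>: "m1 = c * cos \<omega>" "m2 = c * sin \<omega>" using c(1) by (simp_all add: field_simps)
  show thesis
  proof (rule that[OF c(1) sm\<phi> \<phi>nz \<phi>I])
    fix s assume s: "s \<in> L"
    have "\<gamma> s = (x s, y s)" by (simp add: x_def y_def)
    then show "\<gamma> s = c *\<^sub>R rotation \<omega> (\<alpha> (\<phi> s))"
      unfolding rotation_\<alpha> xy[OF s] \<omega> \<theta>_def by (simp add: cos_diff sin_diff algebra_simps)
  qed
qed

section \<open>Passage from arc length to an arbitrary parameter\<close>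

lemma ramp_iff_parametrization:
  "constant_speed_ramp v \<mu> \<beta> S \<and> \<not> treadmill_sled_in_line \<beta> S
     \<longleftrightarrow> (\<exists>\<omega> c T h. c > 0 \<and> T \<subseteq> I \<and> reparametrization h S T \<and>
            (\<forall>t\<in>S. \<beta> t = c *\<^sub>R rotation \<omega> (\<alpha> (h t))))"
proof
  assume *: "constant_speed_ramp v \<mu> \<beta> S \<and> \<not> treadmill_sled_in_line \<beta> S"
  then obtain \<gamma> L where arc: "arc_length_reparam \<beta> S \<gamma> L"
    and \<kappa>: "\<And>s. s \<in> L \<Longrightarrow> curvature L \<gamma> s = - (1 / (v\<^sup>2 * (norm (\<gamma> s))\<^sup>2)) *
             (inner (\<gamma> s) (deriv_on L \<gamma> s) / \<mu> + inner (\<gamma> s) (unit_normal L \<gamma> s))"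
    by (auto simp: constant_speed_ramp_def)
  have curve: "arc_length_curve \<gamma> L" using arc by (simp add: arc_length_reparam_def)
  \<comment> \<open>\<open>treadmill_sled_in_line\<close> asks for some reparametrization, so its
    negation applies to the one that carries the ramp equation.\<close>
  have not_line: "\<not> collinear (treadmill_sled L \<gamma> ` L)"
    using * arc by (auto simp: treadmill_sled_in_line_def)
  obtain \<phi> c \<omega> where c: "c > 0" and \<phi>: "smooth_on_interval L \<phi>"
    "\<And>s. s \<in> L \<Longrightarrow> deriv_on L \<phi> s \<noteq> 0" "\<And>s. s \<in> L \<Longrightarrow> \<phi> s \<in> I"
    and \<gamma>: "\<And>s. s \<in> L \<Longrightarrow> \<gamma> s = c *\<^sub>R rotation \<omega> (\<alpha> (\<phi> s))"
    by (rule parametrization_of_ramp[OF curve \<kappa> not_line]) (assumption | rule that; simp)+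
  obtain \<sigma> where \<sigma>: "reparametrization \<sigma> S L" "\<And>t. t \<in> S \<Longrightarrow> \<beta> t = \<gamma> (\<sigma> t)"
    using arc by (auto simp: arc_length_reparam_def)
  \<comment> \<open>The angle as a function of the original parameter; its image serves as
    \<open>T\<close>.\<close>
  define h where "h t = \<phi> (\<sigma> t)" for t
  have S: "nondegenerate_interval S" and L: "nondegenerate_interval L"
    and \<sigma>s: "smooth_on_interval S \<sigma>" and \<sigma>0: "\<And>t. t \<in> S \<Longrightarrow> deriv_on S \<sigma> t \<noteq> 0"
    and \<sigma>L: "\<And>t. t \<in> S \<Longrightarrow> \<sigma> t \<in> L" and img: "\<sigma> ` S = L"
    using \<sigma>(1) by (auto simp: reparametrization_def bij_betw_def)
  have "ndiff n S h" for n
    unfolding h_def using \<phi>(1) \<sigma>s \<sigma>L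
    by (intro ndiff_compose[of n L \<phi> S \<sigma>])
       (auto simp: smooth_on_interval_iff_ndiff[OF S] smooth_on_interval_iff_ndiff[OF L])
  then have hs: "smooth_on_interval S h"
    using smooth_on_interval_iff_ndiff[OF S] by blast
  have "deriv_on S h t \<noteq> 0" if t: "t \<in> S" for t
  proof -
    have "h = \<phi> \<circ> \<sigma>" by (auto simp: h_def)
    moreover have "((\<phi> \<circ> \<sigma>) has_vector_derivative deriv_on S \<sigma> t *\<^sub>R deriv_on L \<phi> (\<sigma> t)) (at t within S)"
      using smooth_on_intervalD(1)[OF \<sigma>s t] smooth_on_intervalD(1)[OF \<phi>(1) \<sigma>L[OF t]]
      by (intro vector_diff_chain_within) (simp_all add: img)
    ultimately have "deriv_on S h t = deriv_on S \<sigma> t *\<^sub>R deriv_on L \<phi> (\<sigma> t)"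
      by (intro deriv_on_eqI[OF S t]) simp
    then show ?thesis using \<sigma>0[OF t] \<phi>(2)[OF \<sigma>L[OF t]] by simp
  qed
  from reparametrizationI[OF S hs this]
  have "reparametrization h S (h ` S)" .
  moreover have "h ` S \<subseteq> I" using \<phi>(3) \<sigma>L by (auto simp: h_def)
  moreover have "\<forall>t\<in>S. \<beta> t = c *\<^sub>R rotation \<omega> (\<alpha> (h t))"
    using \<sigma>(2) \<gamma> \<sigma>L by (simp add: h_def)
  ultimately show "\<exists>\<omega> c T h. c > 0 \<and> T \<subseteq> I \<and> reparametrization h S T \<and>
            (\<forall>t\<in>S. \<beta> t = c *\<^sub>R rotation \<omega> (\<alpha> (h t)))"
    using c by blast
next
  assume "\<exists>\<omega> c T h. c > 0 \<and> T \<subseteq> I \<and> reparametrization h S T \<and>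
            (\<forall>t\<in>S. \<beta> t = c *\<^sub>R rotation \<omega> (\<alpha> (h t)))"
  then obtain \<omega> c T h where "c > 0" "T \<subseteq> I" "reparametrization h S T"
    and \<beta>: "\<forall>t\<in>S. \<beta> t = c *\<^sub>R rotation \<omega> (\<alpha> (h t))"
    by (elim exE conjE)
  note ramp_of_parametrization[OF this(1-3) bspec[OF \<beta>]]
  then show "constant_speed_ramp v \<mu> \<beta> S \<and> \<not> treadmill_sled_in_line \<beta> S"
    by simp
qed

end

theorem theorem4p5:
  fixes v \<mu> A B :: real
    and r \<Theta> :: "real \<Rightarrow> real"
    and \<alpha> :: "real \<Rightarrow> real \<times> real"
    and I :: "real set"
  assumes "v > 0" and "v \<noteq> 1" and "\<mu> > 0"
    and "B = \<mu> * (v\<^sup>2 - 1)" and "A = 1 + B\<^sup>2"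
    and "\<And>\<phi>. r \<phi> = exp (- (\<mu> * v\<^sup>2 * \<phi> / A)) *
                     (1 / (cos \<phi> + B * sin \<phi>)) powr (\<mu> * v\<^sup>2 * B / A)"
    and "\<And>\<phi>. \<Theta> \<phi> = \<mu> * v\<^sup>2 * (B * \<phi> - ln (B * sin \<phi> + cos \<phi>)) / (B\<^sup>2 + 1)"
    and "\<And>\<phi>. \<alpha> \<phi> = r \<phi> *\<^sub>R (- cos (\<Theta> \<phi>), sin (\<Theta> \<phi>))"
    and "I = {arctan B - pi / 2 <..< arctan B + pi / 2}"
  shows "(\<forall>a b. b - a = pi \<and> 0 \<in> {a<..<b} \<and> (\<forall>\<phi>\<in>{a<..<b}. cos \<phi> + B * sin \<phi> > 0)
            \<longleftrightarrow> a = arctan B - pi / 2 \<and> b = arctan B + pi / 2) \<and>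
         (\<forall>\<beta> S. constant_speed_ramp v \<mu> \<beta> S \<and> \<not> treadmill_sled_in_line \<beta> S
            \<longleftrightarrow> (\<exists>\<omega> c T h. c > 0 \<and> T \<subseteq> I \<and> reparametrization h S T \<and>
                   (\<forall>t\<in>S. \<beta> t = c *\<^sub>R rotation \<omega> (\<alpha> (h t)))))"
proof -
  interpret ramp_family v \<mu> A B r \<Theta> \<alpha> I
    by (rule ramp_family.intro) (fact assms)+
  show ?thesis
    by (intro conjI allI interval_of_positivity ramp_iff_parametrization)
qed

end
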